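(* Let $T$ be a prism truncated tetrahedron with dihedral angles $\mu,\theta_1,\theta_2,\theta_3,\theta_5,\theta_6$ and corresponding edge lengths $\ell,\ell_1,\ell_2,\ell_3,\ell_5,\ell_6$. Then by means of the analytic continuation $a_{12}:=\sqrt{-1}\,\ell$, $\ell_{12}=\sqrt{-1}\,\mu$ we have $$\mathrm{Jac}^{\star}(T):=\frac{\partial (\mu, \ell_1, \ell_2, \ell_3, \ell_5, \ell_6)}{\partial (\ell, \theta_1, \theta_2, \theta_3, \theta_5, \theta_6)} = \frac{\partial (\ell_{12}, \ell_{34}, \ell_{13}, \ell_{23}, \ell_{24}, \ell_{14})}{\partial (a_{12}, a_{34}, a_{13}, a_{23}, a_{24}, a_{14})},$$ where the right-hand side is the Jacobian matrix of a mildly doubly truncated tetrahedron (given in the context), continued analytically.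
   Context: Consider a tetrahedron with vertices $\mathrm{v}_1,\mathrm{v}_2$ ultra-ideal and $\mathrm{v}_3,\mathrm{v}_4$ proper (projective model of $\mathbb{H}^3$), truncated by the polar planes $P_1,P_2$ of $\mathrm{v}_1,\mathrm{v}_2$. Let $e_{ij}$ be the edge joining $\mathrm{v}_i,\mathrm{v}_j$, with dihedral angle $a_{ij}$ and (truncated) length $\ell_{ij}$ (indices symmetric), and let $F_i$ be the face opposite to $\mathrm{v}_i$. The tetrahedron is mildly (doubly) truncated if $P_1$ and $P_2$ do not intersect. It is prism truncated if $P_1$ and $P_2$ intersect; the truncation then removes the edge $e_{12}$ and produces a new edge on $P_1\cap P_2$, of length $\ell$ and with dihedral angle $\mu$. The dihedral angles and lengths of the other edges of a prism truncated $T$ are: $(\theta_1,\ell_1)$ along $e_{34}=F_1\cap F_2$; $(\theta_2,\ell_2)$ along $e_{13}=F_2\cap F_4$; $(\theta_3,\ell_3)$ along $e_{23}=F_1\cap F_4$; $(\theta_5,\ell_5)$ along $e_{24}=F_1\cap F_3$; $(\theta_6,\ell_6)$ along $e_{14}=F_2\cap F_3$. The Gram matrix of the prism truncated $T$ is $$G = \left( \begin{array}{cccc} 1 & -\cos \theta_1 & -\cos \theta_5 & -\cos \theta_3\\ -\cos \theta_1 & 1 & -\cos \theta_6 & -\cos \theta_2\\ -\cos \theta_5 & -\cos \theta_6 & 1 & -\cosh \ell\\ -\cos \theta_3 & -\cos \theta_2 & -\cosh \ell & 1 \end{array} \right),$$ which is the Gram matrix of a mildly truncated tetrahedron (unit diagonal,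 $(i,j)$ entry $-\cos a_{kl}$ for $\{i,j,k,l\}=\{1,2,3,4\}$) with $a_{12}=\sqrt{-1}\,\ell$, $(a_{34},a_{13},a_{23},a_{24},a_{14})=(\theta_1,\theta_2,\theta_3,\theta_5,\theta_6)$; correspondingly $(\ell_{34},\ell_{13},\ell_{23},\ell_{24},\ell_{14})=(\ell_1,\ell_2,\ell_3,\ell_5,\ell_6)$. The Jacobian matrix of the mildly truncated tetrahedron, as stated in the paper: with $\varepsilon_k=+1,0,-1$ for $\mathrm{v}_k$ proper, ideal, ultra-ideal (so here $\varepsilon_1=\varepsilon_2=-1$, $\varepsilon_3=\varepsilon_4=+1$), it is $-\eta\,\mathscr{D}\mathscr{S}\mathscr{D}$, where $$\eta=\left(\frac{\prod_{i=1}^4\varepsilon_i\det G_{ii}}{(-\det G)^3}\right)^{1/2}$$ ($G_{ii}$ is $G$ with row and column $i$ deleted), $\mathscr{D}$ is the diagonal matrix with entries $\sigma_{kl}=\tfrac12 e^{\ell_{kl}}-\tfrac12\varepsilon_k\varepsilon_le^{-\ell_{kl}}$, and, with $\sigma'_{kl}=\tfrac12 e^{\ell_{kl}}+\tfrac12\varepsilon_k\varepsilon_le^{-\ell_{kl}}$, the symmetric matrix $\mathscr{S}$ (rows and columns indexed by edges) has entries, for $\{i,j,k,l\}=\{1,2,3,4\}$: $\mathscr{S}_{kl,ij}=1$; $\mathscr{S}_{kl,ik}=\varepsilon_k\sigma'_{jk}$; $\mathscr{S}_{kl,kl}=\omega_{kl}$, where $$\omega_{kl}=\frac{\sigma'_{ik}\sigma'_{jl}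 + \varepsilon_l \sigma'_{il}\sigma'_{jl}\sigma'_{kl} + \sigma'_{il}\sigma'_{jk} + \varepsilon_k \sigma'_{ik}\sigma'_{jk}\sigma'_{kl}}{\sigma_{kl}^2}.$$
   Formalization: The printed formula for ω_kl has wrong signs: the products σ'_ik σ'_jl and σ'_il σ'_jk must carry minus signs, since with plus signs the diagonal of the Jacobian matrix is wrong for every mildly truncated tetrahedron; the corrected ω_kl is used. *)

theory Defs
  imports "HOL-Analysis.Analysis"
begin

text \<open>Minkowski space is \<open>real \<times> real^3\<close>, with time coordinate \<open>fst\<close>. A point of the projective
  model is represented by a vector: a proper point by its unit timelike representative on the
  hyperboloid, an ultra-ideal point by a unit spacelike one.\<close>

type_synonym minkowski = "real \<times> (real^3)"

definition lor :: "minkowski \<Rightarrow> minkowski \<Rightarrow> real" where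
  "lor x y = snd x \<bullet> snd y - fst x * fst y"

definition H3 :: "minkowski set" where
  "H3 = {x. lor x x = -1 \<and> fst x > 0}"

definition hdist :: "minkowski \<Rightarrow> minkowski \<Rightarrow> real" where
  "hdist x y = arcosh (- lor x y)"

definition polar :: "minkowski \<Rightarrow> minkowski set" where
  "polar u = {x \<in> H3. lor x u = 0}"

text \<open>Edges, in the order in which they index the Jacobian matrices.\<close>

datatype edge = E12 | E34 | E13 | E23 | E24 | E14

instance edge :: finite
proof
  have "x \<in> {E12, E34, E13, E23, E24, E14}" for x
    by (cases x) auto
  then have "(UNIV :: edge set) = {E12, E34, E13, E23, E24, E14}"
    by blast
  then show "finite (UNIV :: edge set)"
    by (metis finite.emptyI finite.insertI)
qed

primrec ends :: "edge \<Rightarrow> 4 \<times> 4" where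
  "ends E12 = (1, 2)"
| "ends E34 = (3, 4)"
| "ends E13 = (1, 3)"
| "ends E23 = (2, 3)"
| "ends E24 = (2, 4)"
| "ends E14 = (1, 4)"

primrec opposite :: "edge \<Rightarrow> edge" where
  "opposite E12 = E34"
| "opposite E34 = E12"
| "opposite E13 = E24"
| "opposite E23 = E14"
| "opposite E24 = E13"
| "opposite E14 = E23"

definition verts :: "edge \<Rightarrow> 4 set" where
  "verts e = {fst (ends e), snd (ends e)}"

definition edge_joining :: "4 \<Rightarrow> 4 \<Rightarrow> edge" where
  "edge_joining k l = (THE e. verts e = {k, l})"

subsection \<open>Truncated tetrahedra\<close>

text \<open>The tetrahedron with vertices \<open>v 1, \<dots>, v 4\<close> is the projectivization of the cone they span; the
  choice between the two representatives \<open>\<plusminus> v 1\<close> (and \<open>\<plusminus> v 2\<close>) is therefore part of the data, and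
  truncation keeps the half-spaces \<open>lor x (v 1) \<le> 0\<close> and \<open>lor x (v 2) \<le> 0\<close>. The proper vertices have to
  lie strictly inside these half-spaces, since they and the edges ending there survive truncation.\<close>

definition doubly_truncated :: "(4 \<Rightarrow> minkowski) \<Rightarrow> bool" where
  "doubly_truncated v \<longleftrightarrow>
     inj v \<and> independent (range v) \<and>
     lor (v 1) (v 1) = 1 \<and> lor (v 2) (v 2) = 1 \<and> v 3 \<in> H3 \<and> v 4 \<in> H3 \<and>
     (\<forall>i\<in>{1, 2}. \<forall>k\<in>{3, 4}. lor (v i) (v k) < 0)"

definition segment :: "(4 \<Rightarrow> minkowski) \<Rightarrow> 4 \<Rightarrow> 4 \<Rightarrow> minkowski set" where
  "segment v k l = {x \<in> H3. \<exists>s\<ge>0. \<exists>t\<ge>0. x = s *\<^sub>R v k + t *\<^sub>R v l}"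

text \<open>The condition on \<open>segment v 1 2\<close> says that the edge \<open>e\<^sub>1\<^sub>2\<close> passes through hyperbolic space. It
  excludes polar planes tangent at infinity (for which its truncated length degenerates to 0) and
  polar planes one of which is cut off by the other.\<close>

definition mildly_truncated :: "(4 \<Rightarrow> minkowski) \<Rightarrow> bool" where
  "mildly_truncated v \<longleftrightarrow>
     doubly_truncated v \<and> polar (v 1) \<inter> polar (v 2) = {} \<and> segment v 1 2 \<noteq> {}"

definition prism_truncated :: "(4 \<Rightarrow> minkowski) \<Rightarrow> bool" where
  "prism_truncated v \<longleftrightarrow> doubly_truncated v \<and> polar (v 1) \<inter> polar (v 2) \<noteq> {}"

definition eps :: "(4 \<Rightarrow> minkowski) \<Rightarrow> 4 \<Rightarrow> real" where
  "eps v k = - sgn (lor (v k) (v k))"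

text \<open>The end of the truncated edge \<open>e\<^sub>k\<^sub>l\<close> at the vertex \<open>v k\<close>.\<close>

definition edge_end :: "(4 \<Rightarrow> minkowski) \<Rightarrow> 4 \<Rightarrow> 4 \<Rightarrow> minkowski" where
  "edge_end v k l =
     (if eps v k = 1 then v k else THE x. x \<in> segment v k l \<inter> polar (v k))"

definition edge_length :: "(4 \<Rightarrow> minkowski) \<Rightarrow> edge \<Rightarrow> real" where
  "edge_length v e = (case ends e of (k, l) \<Rightarrow> hdist (edge_end v k l) (edge_end v l k))"

definition face_plane :: "(4 \<Rightarrow> minkowski) \<Rightarrow> 4 \<Rightarrow> minkowski set" where
  "face_plane v i = H3 \<inter> span (v ` (- {i}))"

definition outward_normal :: "(4 \<Rightarrow> minkowski) \<Rightarrow> 4 \<Rightarrow> minkowski" where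
  "outward_normal v i =
     (THE n. lor n n = 1 \<and> (\<forall>j. j \<noteq> i \<longrightarrow> lor n (v j) = 0) \<and> lor n (v i) < 0)"

definition angle_of_normals :: "minkowski \<Rightarrow> minkowski \<Rightarrow> real" where
  "angle_of_normals m n = arccos (- lor m n)"

text \<open>The edge \<open>e\<^sub>k\<^sub>l\<close> lies on the faces \<open>F\<^sub>i\<close> and \<open>F\<^sub>j\<close>, where \<open>(i, j)\<close> are the ends of the opposite edge.\<close>

definition dihedral_angle :: "(4 \<Rightarrow> minkowski) \<Rightarrow> edge \<Rightarrow> real" where
  "dihedral_angle v e =
     (case ends (opposite e) of (i, j) \<Rightarrow>
        angle_of_normals (outward_normal v i) (outward_normal v j))"

text \<open>The new edge of a prism truncated tetrahedron joins the faces \<open>F\<^sub>3\<close> and \<open>F\<^sub>4\<close>. The outward unit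
  normals of the truncated polyhedron along the polar planes are \<open>v 1\<close> and \<open>v 2\<close>.\<close>

definition new_edge_end :: "(4 \<Rightarrow> minkowski) \<Rightarrow> 4 \<Rightarrow> minkowski" where
  "new_edge_end v i = (THE x. x \<in> polar (v 1) \<inter> polar (v 2) \<inter> face_plane v i)"

definition new_edge_length :: "(4 \<Rightarrow> minkowski) \<Rightarrow> real" where
  "new_edge_length v = hdist (new_edge_end v 3) (new_edge_end v 4)"

definition new_edge_angle :: "(4 \<Rightarrow> minkowski) \<Rightarrow> real" where
  "new_edge_angle v = angle_of_normals (v 1) (v 2)"

subsection \<open>Jacobian matrices of the geometric data\<close>

text \<open>\<open>has_jacobian R p J\<close>: near \<open>p\<close>, the relation \<open>R\<close> is the graph of a function, and that function
  is differentiable at \<open>p\<close> with Jacobian matrix \<open>J\<close>. (So \<open>J\<close> is unique.)\<close>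

definition has_jacobian ::
  "((real^'n::finite) \<times> (real^'m::finite)) set \<Rightarrow> real^'n \<Rightarrow> real^'n^'m \<Rightarrow> bool" where
  "has_jacobian R p J \<longleftrightarrow>
     (\<exists>f. (\<forall>\<^sub>F x in nhds p. \<forall>y. (x, y) \<in> R \<longleftrightarrow> y = f x) \<and>
          (f has_derivative (\<lambda>h. J *v h)) (at p))"

definition mild_angles :: "(4 \<Rightarrow> minkowski) \<Rightarrow> real^edge" where
  "mild_angles v = (\<chi> e. dihedral_angle v e)"

definition mild_lengths :: "(4 \<Rightarrow> minkowski) \<Rightarrow> real^edge" where
  "mild_lengths v = (\<chi> e. edge_length v e)"

definition prism_args :: "(4 \<Rightarrow> minkowski) \<Rightarrow> real^edge"
  \<comment> \<open>\<open>(\<ell>, \<theta>\<^sub>1, \<theta>\<^sub>2, \<theta>\<^sub>3, \<theta>\<^sub>5, \<theta>\<^sub>6)\<close>\<close> where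
  "prism_args v = (\<chi> e. if e = E12 then new_edge_length v else dihedral_angle v e)"

definition prism_vals :: "(4 \<Rightarrow> minkowski) \<Rightarrow> real^edge"
  \<comment> \<open>\<open>(\<mu>, \<ell>\<^sub>1, \<ell>\<^sub>2, \<ell>\<^sub>3, \<ell>\<^sub>5, \<ell>\<^sub>6)\<close>\<close> where
  "prism_vals v = (\<chi> e. if e = E12 then new_edge_angle v else edge_length v e)"

definition is_mild_Jac :: "(4 \<Rightarrow> minkowski) \<Rightarrow> real^edge^edge \<Rightarrow> bool" where
  "is_mild_Jac v J \<longleftrightarrow>
     has_jacobian {(mild_angles w, mild_lengths w) | w. mildly_truncated w} (mild_angles v) J"

definition is_Jac_star :: "(4 \<Rightarrow> minkowski) \<Rightarrow> real^edge^edge \<Rightarrow> bool" where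
  "is_Jac_star v J \<longleftrightarrow>
     has_jacobian {(prism_args w, prism_vals w) | w. prism_truncated w} (prism_args v) J"

subsection \<open>The matrix $-\eta\mathscr{D}\mathscr{S}\mathscr{D}$ for complex angles \<open>a\<close> and lengths \<open>l\<close>\<close>

definition gram :: "complex^edge \<Rightarrow> complex^4^4" where
  "gram a = (\<chi> i j. if i = j then 1 else - cos (a $ opposite (edge_joining i j)))"

text \<open>The determinant of \<open>A\<close> with row and column \<open>i\<close> deleted.\<close>

definition principal_minor :: "complex^4^4 \<Rightarrow> 4 \<Rightarrow> complex" where
  "principal_minor A i =
     (\<Sum>p\<in>{p. p permutes (- {i})}. of_int (sign p) * (\<Prod>k\<in>- {i}. A $ k $ p k))"

definition eta :: "(4 \<Rightarrow> real) \<Rightarrow> complex^edge \<Rightarrow> complex" where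
  "eta \<epsilon> a =
     csqrt ((\<Prod>i\<in>UNIV. of_real (\<epsilon> i) * principal_minor (gram a) i) / (- det (gram a)) ^ 3)"

definition sig :: "(4 \<Rightarrow> real) \<Rightarrow> complex^edge \<Rightarrow> 4 \<Rightarrow> 4 \<Rightarrow> complex" where
  "sig \<epsilon> l k m =
     exp (l $ edge_joining k m) / 2 - of_real (\<epsilon> k * \<epsilon> m) * exp (- (l $ edge_joining k m)) / 2"

definition sig' :: "(4 \<Rightarrow> real) \<Rightarrow> complex^edge \<Rightarrow> 4 \<Rightarrow> 4 \<Rightarrow> complex" where
  "sig' \<epsilon> l k m =
     exp (l $ edge_joining k m) / 2 + of_real (\<epsilon> k * \<epsilon> m) * exp (- (l $ edge_joining k m)) / 2"

text \<open>The two products without a factor \<open>\<epsilon>\<close> carry a minus sign. With all four signs positive, as in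
  the source, the diagonal of the matrix below is not that of the Jacobian matrix of a mildly
  truncated tetrahedron (nor that of a compact one).\<close>

definition omega :: "(4 \<Rightarrow> real) \<Rightarrow> complex^edge \<Rightarrow> edge \<Rightarrow> complex" where
  "omega \<epsilon> l e =
     (case (ends e, ends (opposite e)) of ((k, m), (i, j)) \<Rightarrow>
        (- sig' \<epsilon> l i k * sig' \<epsilon> l j m
         + of_real (\<epsilon> m) * sig' \<epsilon> l i m * sig' \<epsilon> l j m * sig' \<epsilon> l k m
         - sig' \<epsilon> l i m * sig' \<epsilon> l j k
         + of_real (\<epsilon> k) * sig' \<epsilon> l i k * sig' \<epsilon> l j k * sig' \<epsilon> l k m) / (sig \<epsilon> l k m)\<^sup>2)"

definition Dmat :: "(4 \<Rightarrow> real) \<Rightarrow> complex^edge \<Rightarrow> complex^edge^edge" where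
  "Dmat \<epsilon> l = (\<chi> e f. if e = f then sig \<epsilon> l (fst (ends e)) (snd (ends e)) else 0)"

text \<open>In the last case \<open>k\<close> is the common vertex of the two edges, and \<open>j\<close> is the vertex on neither.\<close>

definition Smat :: "(4 \<Rightarrow> real) \<Rightarrow> complex^edge \<Rightarrow> complex^edge^edge" where
  "Smat \<epsilon> l =
     (\<chi> e f. if f = e then omega \<epsilon> l e
             else if f = opposite e then 1
             else let k = (THE k. k \<in> verts e \<inter> verts f);
                      j = (THE j. j \<notin> verts e \<union> verts f)
                  in of_real (\<epsilon> k) * sig' \<epsilon> l j k)"

definition Jac_formula :: "(4 \<Rightarrow> real) \<Rightarrow> complex^edge \<Rightarrow> complex^edge \<Rightarrow> complex^edge^edge" where
  "Jac_formula \<epsilon> a l = mat (- eta \<epsilon> a) ** Dmat \<epsilon> l ** Smat \<epsilon> l ** Dmat \<epsilon> l"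

text \<open>The substitution \<open>a\<^sub>1\<^sub>2 = \<i> \<ell>\<close>, \<open>\<ell>\<^sub>1\<^sub>2 = \<i> \<mu>\<close>. On a matrix of partial derivatives it acts by the chain
  rule, \<open>\<partial>\<ell>\<^sub>1\<^sub>2 = \<i> \<partial>\<mu>\<close> in the numerators and \<open>\<partial>a\<^sub>1\<^sub>2 = \<i> \<partial>\<ell>\<close> in the denominators.\<close>

definition unit_factor :: "edge \<Rightarrow> complex" where
  "unit_factor e = (if e = E12 then \<i> else 1)"

definition continued :: "real^edge \<Rightarrow> complex^edge" where
  "continued x = (\<chi> e. unit_factor e * of_real (x $ e))"

definition continued_jacobian :: "real^edge^edge \<Rightarrow> complex^edge^edge" where
  "continued_jacobian J = (\<chi> e f. unit_factor e * of_real (J $ e $ f) / unit_factor f)"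

end

theory Submission
  imports Defs
begin

text \<open>Let \<open>G\<close> be the Gram matrix of the outward unit normals of the four faces and \<open>H\<close> that of the normalized
vertices. Each normal is orthogonal to three of the vertices, so the normals and the vertices are dual
bases up to scaling; with \<open>M = G\<inverse>\<close>, \<open>\<delta>\<^sub>i = H\<^sub>i\<^sub>i = \<plusminus>1\<close> and \<open>d\<^sub>i = sqrt (\<delta>\<^sub>i M\<^sub>i\<^sub>i)\<close> this reads
\<open>H\<^sub>i\<^sub>j = M\<^sub>i\<^sub>j / (d\<^sub>i d\<^sub>j)\<close> (\<open>gram_normals_inverse\<close>). The entries of \<open>G\<close> are \<open>- cos\<close> of the dihedral angles, with
\<open>- cosh \<ell>\<close> in place of \<open>- cos a\<^sub>1\<^sub>2\<close> in the prism truncated case, and each edge length is \<open>arcosh\<close>, \<open>arsinh\<close>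
or, for \<open>\<mu>\<close>, \<open>arccos\<close> of an entry of \<open>- H\<close>. Hence the lengths are an explicit function \<open>length_map\<close> of
the angles, and its derivative is a matter of linear algebra.

From \<open>dM = - M dG M\<close> (\<open>has_derivative_cramer_inverse\<close>) one gets \<open>dH\<close> as a polynomial expression in \<open>H\<close> times
the scaled increments \<open>d\<^sub>p dG\<^sub>p\<^sub>q d\<^sub>q\<close>; the three kinds of coefficients (\<open>{p, q}\<close> equal to \<open>{i, j}\<close>, meeting it in one
vertex, or disjoint from it) are the three kinds of entries of \<open>\<S>\<close>. The increments \<open>dG\<^sub>p\<^sub>q = sin a\<^sub>k\<^sub>l da\<^sub>k\<^sub>l\<close> contain
sines, and Jacobi's identity between complementary minors of \<open>G\<close> and \<open>M\<close> turns them into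
\<open>sin a\<^sub>k\<^sub>l = sqrt (- det G) \<sigma>\<^sub>k\<^sub>l d\<^sub>k d\<^sub>l\<close> (\<open>sine_eq\<close>), so that the common factor
\<open>\<eta> = sqrt (- det G) d\<^sub>1 d\<^sub>2 d\<^sub>3 d\<^sub>4\<close> splits off.

The mildly and the prism truncated case are treated together. They differ only in the sign of
\<open>H\<^sub>1\<^sub>2\<^sup>2 - 1\<close>: replacing hyperbolic by trigonometric functions at the edge \<open>e\<^sub>1\<^sub>2\<close> costs a sign \<open>\<kappa>\<close> in
the derivative of the length and another one in the derivative of the angle, and \<open>\<kappa>\<close> is the square
of the factor \<open>\<i>\<close> in the substitution \<open>a\<^sub>1\<^sub>2 = \<i> \<ell>\<close>, \<open>\<ell>\<^sub>1\<^sub>2 = \<i> \<mu>\<close>. This is the analytic continuation.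

A Jacobian matrix of the geometric relation exists only if all vectors near the given angles are
angles of a tetrahedron. Here \<open>G\<close> is realized by a Cholesky factorization (\<open>ex_vectors_with_gram\<close>) and the
vertices are the scaled dual basis; what makes them a truncated tetrahedron of the right kind is a
list of strict inequalities, which persist near a solution (\<open>eventually_realizable\<close>).\<close>

section \<open>Determinants and inverse matrices\<close>

text \<open>Laplace expansion along the first row, and again along the second.\<close>
lemma det_4:
  "det (A::'a::comm_ring_1^4^4) =
    A$1$1 * (A$2$2 * (A$3$3 * A$4$4 - A$3$4 * A$4$3) - A$2$3 * (A$3$2 * A$4$4 - A$3$4 * A$4$2)
             + A$2$4 * (A$3$2 * A$4$3 - A$3$3 * A$4$2))
  - A$1$2 * (A$2$1 * (A$3$3 * A$4$4 - A$3$4 * A$4$3) - A$2$3 * (A$3$1 * A$4$4 - A$3$4 * A$4$1)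
             + A$2$4 * (A$3$1 * A$4$3 - A$3$3 * A$4$1))
  + A$1$3 * (A$2$1 * (A$3$2 * A$4$4 - A$3$4 * A$4$2) - A$2$2 * (A$3$1 * A$4$4 - A$3$4 * A$4$1)
             + A$2$4 * (A$3$1 * A$4$2 - A$3$2 * A$4$1))
  - A$1$4 * (A$2$1 * (A$3$2 * A$4$3 - A$3$3 * A$4$2) - A$2$2 * (A$3$1 * A$4$3 - A$3$3 * A$4$1)
             + A$2$3 * (A$3$1 * A$4$2 - A$3$2 * A$4$1))"
proof -
  have f1234: "finite {2::4, 3, 4}" "1 \<notin> {2::4, 3, 4}"
    and f234: "finite {3::4, 4}" "2 \<notin> {3::4, 4}"
    and f34: "finite {4::4}" "3 \<notin> {4::4}"
    by auto
  show ?thesis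
    unfolding det_def UNIV_4
    unfolding sum_over_permutations_insert[OF f1234]
    unfolding sum_over_permutations_insert[OF f234]
    unfolding sum_over_permutations_insert[OF f34]
    unfolding permutes_sing
    by (simp add: sign_swap_id permutation_swap_id permutation_compose sign_compose sign_id swap_id_eq
        transpose_def algebra_simps)
qed

text \<open>Cramer's rule gives the inverse as a quotient of polynomials in the entries, which is why it is
  differentiable.\<close>
definition cramer_inverse :: "'a::field^'n^'n \<Rightarrow> 'a^'n^'n::finite" where
  "cramer_inverse A = (\<chi> k l. det (\<chi> i j. if j = k then axis l 1 $ i else A $ i $ j) / det A)"

lemma cramer_inverse:
  fixes A :: "'a::field^'n^'n::finite"
  assumes "det A \<noteq> 0"
  shows "A ** cramer_inverse A = mat 1"
proof -
  have "(A ** cramer_inverse A) $ i $ l = mat 1 $ i $ l" for i l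
  proof -
    have "A *v (\<chi> k. cramer_inverse A $ k $ l) = axis l 1"
      by (subst cramer[OF assms]) (simp add: cramer_inverse_def)
    then have "(A *v (\<chi> k. cramer_inverse A $ k $ l)) $ i = axis l 1 $ i"
      by simp
    then show ?thesis
      by (simp add: matrix_matrix_mult_def matrix_vector_mult_def mat_def axis_def eq_commute)
  qed
  then show ?thesis by (simp add: vec_eq_iff)
qed

lemma cramer_inverse_unique:
  fixes A :: "'a::field^'n^'n::finite"
  assumes "A ** B = mat 1"
  shows "cramer_inverse A = B"
proof -
  have d: "det A \<noteq> 0"
    using assms by (metis det_I det_mul mult_zero_left zero_neq_one)
  have "B ** A = mat 1"
    using assms matrix_left_right_inverse by blast
  then show ?thesis
    by (metis cramer_inverse[OF d] matrix_mul_assoc matrix_mul_lid matrix_mul_rid)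
qed

text \<open>In the determinant on the right only permutations fixing \<open>i\<close> contribute, and these are the
  permutations of the remaining indices. The determinant is the one in Cramer's rule for the
  diagonal entry of the inverse.\<close>
lemma principal_minor_eq_det:
  "principal_minor A i = det (\<chi> a b. if b = i then axis i 1 $ a else A $ a $ b)"
proof -
  let ?B = "(\<chi> a b. if b = i then axis i 1 $ a else A $ a $ b) :: complex^4^4"
  have *: "of_int (sign p) * (\<Prod>a\<in>UNIV. ?B $ a $ p a) = 0"
    if p: "p permutes UNIV" "\<not> p permutes - {i}" for p
  proof -
    obtain a where a: "p a = i" using permutes_surj[OF p(1)] by (metis surjD)
    have "a \<noteq> i"
    proof
      assume "a = i"
      then have "p permutes - {i}"
        using a by (intro permutes_superset[OF p(1)]) auto
      then show False using p by simp
    qed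
    then have "?B $ a $ p a = 0" using a by (simp add: axis_def)
    then have "(\<Prod>a\<in>UNIV. ?B $ a $ p a) = 0" by (meson UNIV_I finite prod_zero)
    then show ?thesis by simp
  qed
  have **: "(\<Prod>k\<in>- {i}. A $ k $ p k) = (\<Prod>a\<in>UNIV. ?B $ a $ p a)" if p: "p permutes - {i}" for p
  proof -
    have pi: "p i = i" using p by (simp add: permutes_def)
    have "p k \<noteq> i" if "k \<noteq> i" for k
      using p pi that by (metis permutes_inj injD)
    then have "(\<Prod>k\<in>- {i}. A $ k $ p k) = (\<Prod>k\<in>- {i}. ?B $ k $ p k)"
      by (intro prod.cong) auto
    also have "\<dots> = (\<Prod>a\<in>insert i (- {i}). ?B $ a $ p a)"
      using pi by (subst prod.insert) (auto simp: axis_def)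
    also have "insert i (- {i}) = UNIV" by auto
    finally show ?thesis .
  qed
  have "principal_minor A i = (\<Sum>p | p permutes - {i}. of_int (sign p) * (\<Prod>a\<in>UNIV. ?B $ a $ p a))"
    unfolding principal_minor_def using ** by (intro sum.cong) auto
  also have "\<dots> = det ?B"
    unfolding det_def
    using * permutes_subset[of _ "- {i}" UNIV]
    by (intro sum.mono_neutral_left) (auto intro: finite_permutations)
  finally show ?thesis .
qed

lemma det_simultaneous_permutation:
  fixes A :: "'a::comm_ring_1^'n^'n::finite"
  assumes "p permutes UNIV"
  shows "det (\<chi> a b. A $ p a $ p b) = det A"
proof -
  have "det (\<chi> a b. A $ p a $ p b) = of_int (sign p) * det (\<chi> a. A $ p a)"
    using det_permute_columns[OF assms, of "\<chi> a. A $ p a"] by simp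
  also have "\<dots> = (of_int (sign p) * of_int (sign p)) * det A"
    using det_permute_rows[OF assms, of A] by (simp add: mult.assoc)
  also have "(of_int (sign p) * of_int (sign p) :: 'a) = 1"
    by (metis of_int_1 of_int_mult sign_idempotent)
  finally show ?thesis by simp
qed

text \<open>Jacobi's identity: multiply \<open>A\<close> by the matrix made of two columns of the identity and two columns of \<open>M\<close>.
  The product has two columns of \<open>A\<close> and two of the identity, so both determinants are minors of size two.\<close>
lemma jacobi_complementary_minor_1234:
  fixes A M :: "'a::field^4^4"
  assumes AM: "A ** M = mat 1"
  shows "A$1$1 * A$2$2 - A$1$2 * A$2$1 = det A * (M$3$3 * M$4$4 - M$3$4 * M$4$3)"
proof -
  define N where "N = (\<chi> a b. if b = 3 \<or> b = 4 then M $ a $ b else mat 1 $ a $ b)"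
  have "(A ** N) $ a $ b = (if b = 3 \<or> b = 4 then mat 1 $ a $ b else A $ a $ b)" for a b
  proof (cases "b = 3 \<or> b = 4")
    case True
    then have "(A ** N) $ a $ b = (A ** M) $ a $ b"
      by (auto simp: matrix_matrix_mult_def N_def)
    then show ?thesis using True AM by simp
  next
    case False
    then have "(A ** N) $ a $ b = (A ** mat 1) $ a $ b"
      unfolding matrix_matrix_mult_def N_def by simp
    then show ?thesis using False by simp
  qed
  then have AN: "A ** N = (\<chi> a b. if b = 3 \<or> b = 4 then mat 1 $ a $ b else A $ a $ b)"
    by (simp add: vec_eq_iff)
  have "det N = M$3$3 * M$4$4 - M$3$4 * M$4$3"
    by (simp add: det_4 N_def mat_def)
  moreover have "det (A ** N) = A$1$1 * A$2$2 - A$1$2 * A$2$1"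
    unfolding AN by (simp add: det_4 mat_def algebra_simps)
  ultimately show ?thesis by (simp add: det_mul)
qed

lemma jacobi_complementary_minor:
  fixes A M :: "'a::field^4^4"
  assumes AM: "A ** M = mat 1" and d: "distinct [i, j, k, l]"
  shows "A$i$i * A$j$j - A$i$j * A$j$i = det A * (M$k$k * M$l$l - M$k$l * M$l$k)"
proof -
  \<comment> \<open>Relabelling the indices reduces the claim to rows and columns 1, 2 against 3, 4.\<close>
  define p where "p a = (if a = 1 then i else if a = 2 then j else if a = 3 then k else l)" for a :: 4
  have inj: "inj p"
    using d unfolding inj_def forall_4 p_def by auto
  then have bij: "bij p"
    using finite_UNIV_inj_surj[OF finite inj] by (rule bijI)
  then have p: "p permutes UNIV"
    unfolding permutes_def bij_iff by blast
  have "((\<chi> a b. A $ p a $ p b) ** (\<chi> a b. M $ p a $ p b)) $ a $ b = (A ** M) $ p a $ p b" for a b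
    using sum.reindex_bij_betw[OF bij, of "\<lambda>c. A $ p a $ c * M $ c $ p b"]
    by (simp add: matrix_matrix_mult_def)
  then have "(\<chi> a b. A $ p a $ p b) ** (\<chi> a b. M $ p a $ p b) = mat 1"
    unfolding vec_eq_iff AM by (simp add: mat_def inj_eq[OF inj])
  from jacobi_complementary_minor_1234[OF this, unfolded det_simultaneous_permutation[OF p]]
  show ?thesis
    unfolding vec_lambda_beta p_def by simp
qed

section \<open>Minkowski space and outward normals\<close>

lemma lor_commute: "lor x y = lor y x"
  by (simp add: lor_def inner_commute mult.commute)

lemma bilinear_lor: "bilinear lor"
  by (auto simp: bilinear_def lor_def linear_iff algebra_simps inner_simps)

lemmas lor_simps =
  bilinear_ladd[OF bilinear_lor] bilinear_radd[OF bilinear_lor]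
  bilinear_lsub[OF bilinear_lor] bilinear_rsub[OF bilinear_lor]
  bilinear_lmul[OF bilinear_lor] bilinear_rmul[OF bilinear_lor]
  bilinear_lneg[OF bilinear_lor] bilinear_rneg[OF bilinear_lor]
  bilinear_lzero[OF bilinear_lor] bilinear_rzero[OF bilinear_lor]

lemma lor_sum_left: "lor (\<Sum>i\<in>A. f i) y = (\<Sum>i\<in>A. lor (f i) y)"
  using linear_sum[of "\<lambda>x. lor x y" f A] bilinear_lor unfolding bilinear_def by blast

lemma lor_sum_right: "lor x (\<Sum>i\<in>A. f i) = (\<Sum>i\<in>A. lor x (f i))"
  by (subst lor_commute) (simp add: lor_sum_left lor_commute[of x])

lemma lor_nondegenerate:
  assumes "\<And>y. lor x y = 0"
  shows "x = 0"
proof -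
  have "lor x (- fst x, snd x) = 0" by (rule assms)
  then have "snd x \<bullet> snd x + (fst x)\<^sup>2 = 0" by (simp add: lor_def power2_eq_square)
  then have "snd x \<bullet> snd x = 0 \<and> fst x = 0"
    by (smt (verit) inner_ge_zero zero_le_power2 power2_eq_iff_nonneg zero_eq_power2)
  then show ?thesis by (simp add: prod_eq_iff)
qed

text \<open>If \<open>x\<close> were not spacelike, its time coordinate would dominate its space part, as it does for \<open>t\<close>, and
  the Cauchy-Schwarz inequality would forbid \<open>lor x t = 0\<close>.\<close>
lemma spacelike_if_orthogonal_to_timelike:
  assumes t: "lor t t < 0" and orth: "lor x t = 0" and "x \<noteq> 0"
  shows "lor x x > 0"
proof (rule ccontr)
  assume "\<not> lor x x > 0"
  then have sx: "snd x \<bullet> snd x \<le> (fst x)\<^sup>2" by (simp add: lor_def power2_eq_square)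
  have st: "snd t \<bullet> snd t < (fst t)\<^sup>2" using t by (simp add: lor_def power2_eq_square)
  have "fst x \<noteq> 0"
  proof
    assume "fst x = 0"
    then have "snd x \<bullet> snd x = 0"
      using sx inner_ge_zero[of "snd x"] by simp
    then have "x = 0" using \<open>fst x = 0\<close> by (simp add: prod_eq_iff)
    then show False using \<open>x \<noteq> 0\<close> by simp
  qed
  then have "(fst x)\<^sup>2 * (snd t \<bullet> snd t) < (fst x)\<^sup>2 * (fst t)\<^sup>2"
    using st by simp
  moreover have "(snd x \<bullet> snd x) * (snd t \<bullet> snd t) \<le> (fst x)\<^sup>2 * (snd t \<bullet> snd t)"
    using sx by (intro mult_right_mono) auto
  moreover have "(snd x \<bullet> snd t)\<^sup>2 \<le> (snd x \<bullet> snd x) * (snd t \<bullet> snd t)"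
    by (rule Cauchy_Schwarz_ineq)
  moreover have "(snd x \<bullet> snd t)\<^sup>2 = (fst x)\<^sup>2 * (fst t)\<^sup>2"
    using orth by (simp add: lor_def power_mult_distrib)
  ultimately show False by linarith
qed

lemma timelike_same_cone_iff:
  assumes x: "lor x x < 0" and y: "lor y y < 0"
  shows "lor x y < 0 \<longleftrightarrow> fst x * fst y > 0"
proof -
  have *: "norm (snd z) < \<bar>fst z\<bar>" if "lor z z < 0" for z
  proof (rule power2_less_imp_less)
    show "(norm (snd z))\<^sup>2 < \<bar>fst z\<bar>\<^sup>2"
      using that unfolding lor_def power2_norm_eq_inner power2_abs by (simp add: power2_eq_square)
  qed simp
  have "norm (snd x) * norm (snd y) < \<bar>fst x * fst y\<bar>"
    using *[OF x] *[OF y] unfolding abs_mult by (intro mult_strict_mono') auto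
  moreover have "\<bar>snd x \<bullet> snd y\<bar> \<le> norm (snd x) * norm (snd y)"
    by (rule Cauchy_Schwarz_ineq2)
  ultimately show ?thesis unfolding lor_def by linarith
qed

text \<open>The component of \<open>y\<close> orthogonal to \<open>x\<close> is spacelike, and its square is \<open>(lor x y)\<^sup>2 - 1\<close>.\<close>
lemma lor_less_minus_one:
  assumes x: "x \<in> H3" and y: "y \<in> H3" and "x \<noteq> y"
  shows "lor x y < -1"
proof -
  have *: "lor x x = -1" "lor y y = -1" using x y by (auto simp: H3_def)
  have neg: "lor x y < 0"
    using timelike_same_cone_iff[of x y] x y by (simp add: H3_def)
  define b where "b = lor x y"
  have "b < 0" using neg by (simp add: b_def)
  have "y + b *\<^sub>R x \<noteq> 0"
  proof
    assume "y + b *\<^sub>R x = 0"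
    then have y_eq: "y = (- b) *\<^sub>R x" by (simp add: eq_neg_iff_add_eq_0)
    then have "lor y y = b\<^sup>2 * lor x x" by (simp add: lor_simps power2_eq_square)
    then have "b = -1" using * \<open>b < 0\<close> by (simp add: power2_eq_1_iff)
    then show False using y_eq \<open>x \<noteq> y\<close> by simp
  qed
  moreover have "lor (y + b *\<^sub>R x) x = 0"
    using * by (simp add: b_def lor_simps lor_commute)
  ultimately have "lor (y + b *\<^sub>R x) (y + b *\<^sub>R x) > 0"
    using * spacelike_if_orthogonal_to_timelike[of x] by simp
  also have "lor (y + b *\<^sub>R x) (y + b *\<^sub>R x) = b\<^sup>2 - 1"
    using * by (simp add: lor_simps lor_commute[of y x] power2_eq_square flip: b_def)
  finally have "1\<^sup>2 < (- b)\<^sup>2" by simp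
  then have "1 < - b"
    using \<open>b < 0\<close> power_less_imp_less_base[of 1 2 "- b"] by simp
  then show ?thesis by (simp add: b_def)
qed

lemma ex_combination:
  fixes v :: "'a::finite \<Rightarrow> 'b::real_vector"
  assumes "inj v" "span (range v) = UNIV"
  obtains b where "x = (\<Sum>i\<in>UNIV. b i *\<^sub>R v i)"
proof -
  have "x \<in> range (\<lambda>u. \<Sum>y\<in>range v. u y *\<^sub>R y)"
    using assms(2) by (subst span_finite[symmetric]) auto
  then obtain u where "x = (\<Sum>y\<in>range v. u y *\<^sub>R y)" by blast
  then have "x = (\<Sum>i\<in>UNIV. u (v i) *\<^sub>R v i)"
    using sum.reindex[OF \<open>inj v\<close>, of "\<lambda>y. u y *\<^sub>R y"] by simp
  then show thesis by (rule that)
qed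

lemma span_range_eq_UNIV:
  fixes v :: "4 \<Rightarrow> minkowski"
  assumes "inj v" "independent (range v)"
  shows "span (range v) = UNIV"
proof -
  have "card (range v) = 4" using card_image[OF \<open>inj v\<close>] by simp
  then have "dim (UNIV :: minkowski set) \<le> card (range v)" by simp
  then show ?thesis
    using card_ge_dim_independent[of "range v" UNIV] assms(2) by auto
qed

lemma eq_0_if_orthogonal_to_spanning:
  fixes v :: "'a::finite \<Rightarrow> minkowski"
  assumes "inj v" "span (range v) = UNIV" and "\<And>j. lor x (v j) = 0"
  shows "x = 0"
proof (rule lor_nondegenerate)
  fix y
  obtain b where "y = (\<Sum>i\<in>UNIV. b i *\<^sub>R v i)"
    using ex_combination[OF assms(1,2), of y] by blast
  then show "lor x y = 0" using assms(3) by (simp add: lor_sum_right lor_simps)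
qed

text \<open>The defining property of \<open>outward_normal\<close> as a predicate on families: realizing given angles produces
  the normals before the tetrahedron, and they are identified afterwards by uniqueness.\<close>
definition outward_normals :: "(4 \<Rightarrow> minkowski) \<Rightarrow> (4 \<Rightarrow> minkowski) \<Rightarrow> bool" where
  "outward_normals v n \<longleftrightarrow>
     (\<forall>i. lor (n i) (n i) = 1 \<and> (\<forall>j. j \<noteq> i \<longrightarrow> lor (n i) (v j) = 0) \<and> lor (n i) (v i) < 0)"

text \<open>The Gram matrix of a basis is invertible because the form is nondegenerate; its inverse gives the
  coefficients of the dual basis.\<close>
lemma ex_dual_family:
  fixes v :: "4 \<Rightarrow> minkowski"
  assumes v: "inj v" "independent (range v)"
  shows "\<exists>m. \<forall>i j. lor (m i) (v j) = (if i = j then -1 else 0)"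
proof -
  define A where "A = (\<chi> i j. lor (v i) (v j))"
  have spn: "span (range v) = UNIV" using v by (rule span_range_eq_UNIV)
  have "b = 0" if "A *v b = 0" for b
  proof -
    define x where "x = (\<Sum>i\<in>UNIV. b $ i *\<^sub>R v i)"
    have "lor x (v j) = (A *v b) $ j" for j
      by (simp add: x_def A_def matrix_vector_mult_def lor_sum_left lor_simps
          lor_commute[of "v j"] mult.commute)
    then have "x = 0"
      using eq_0_if_orthogonal_to_spanning[OF v(1) spn] that by simp
    then have "(\<Sum>y\<in>range v. b $ inv v y *\<^sub>R y) = 0"
      using sum.reindex[OF v(1), of "\<lambda>y. b $ inv v y *\<^sub>R y"] v(1) by (simp add: x_def)
    then have "b $ inv v y = 0" if "y \<in> range v" for y
      using v(2) that independentD[of "range v" "range v" "\<lambda>y. b $ inv v y" y] by auto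
    then have "b $ i = 0" for i
      using inv_f_f[OF v(1), of i] by (metis rangeI)
    then show "b = 0" by (simp add: vec_eq_iff)
  qed
  then obtain K where K: "K ** A = mat 1"
    using matrix_left_invertible_ker[of A] by blast
  define m where "m i = - (\<Sum>k\<in>UNIV. K $ i $ k *\<^sub>R v k)" for i
  have "lor (m i) (v j) = - (K ** A) $ i $ j" for i j
    by (simp add: m_def A_def matrix_matrix_mult_def lor_sum_left lor_simps)
  then have "lor (m i) (v j) = (if i = j then -1 else 0)" for i j
    by (simp add: K mat_def)
  then show ?thesis by blast
qed

lemma outward_normals_unique:
  fixes v :: "4 \<Rightarrow> minkowski"
  assumes v: "inj v" "independent (range v)"
    and n: "lor n n = 1" "\<forall>j. j \<noteq> i \<longrightarrow> lor n (v j) = 0" "lor n (v i) < 0"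
    and m: "lor m m = 1" "\<forall>j. j \<noteq> i \<longrightarrow> lor m (v j) = 0" "lor m (v i) < 0"
  shows "n = m"
proof -
  define a where "a = lor n (v i) / lor m (v i)"
  have "a > 0" using n m by (simp add: a_def zero_less_divide_iff)
  have "lor (n - a *\<^sub>R m) (v j) = 0" for j
    using n m by (cases "j = i") (auto simp: lor_simps a_def)
  then have "n - a *\<^sub>R m = 0"
    using eq_0_if_orthogonal_to_spanning[OF v(1) span_range_eq_UNIV[OF v]] by blast
  then have n_eq: "n = a *\<^sub>R m" by simp
  then have "a\<^sup>2 = 1" using n(1) m(1) by (simp add: lor_simps power2_eq_square)
  then have "a = 1" using \<open>a > 0\<close> by (simp add: power2_eq_1_iff)
  then show ?thesis using n_eq by simp
qed

lemma outward_normal_eq: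
  assumes v: "inj v" "independent (range v)" and "outward_normals v n"
  shows "outward_normal v = n"
proof
  fix i
  show "outward_normal v i = n i"
    unfolding outward_normal_def
  proof (rule the_equality)
    show n: "lor (n i) (n i) = 1 \<and> (\<forall>j. j \<noteq> i \<longrightarrow> lor (n i) (v j) = 0) \<and> lor (n i) (v i) < 0"
      using assms(3) by (simp add: outward_normals_def)
    show "m = n i"
      if "lor m m = 1 \<and> (\<forall>j. j \<noteq> i \<longrightarrow> lor m (v j) = 0) \<and> lor m (v i) < 0" for m
      using that n outward_normals_unique[OF v, of m i "n i"] by blast
  qed
qed

text \<open>A member of the dual family can be normalized because it is orthogonal to a timelike vertex, hence spacelike.\<close>
lemma outward_normals_outward_normal:
  assumes v: "inj v" "independent (range v)"
    and timelike: "\<And>i. \<exists>k. k \<noteq> i \<and> lor (v k) (v k) < 0"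
  shows "outward_normals v (outward_normal v)"
proof -
  obtain m where m: "\<And>i j. lor (m i) (v j) = (if i = j then -1 else 0)"
    using ex_dual_family[OF v] by blast
  have pos: "lor (m i) (m i) > 0" for i
  proof -
    obtain k where k: "k \<noteq> i" "lor (v k) (v k) < 0" using timelike by blast
    moreover have "m i \<noteq> 0" using m[of i i] by (auto simp: lor_simps)
    ultimately show ?thesis
      using spacelike_if_orthogonal_to_timelike[of "v k" "m i"] m by simp
  qed
  define n where "n i = (1 / sqrt (lor (m i) (m i))) *\<^sub>R m i" for i
  have n: "outward_normals v n"
    unfolding outward_normals_def n_def using m pos pos[THEN less_imp_neq, symmetric]
    by (simp add: lor_simps less_imp_le)
  then show ?thesis using outward_normal_eq[OF v n] by simp
qed

text \<open>The coefficient of \<open>v j\<close> in \<open>n i\<close> is found by pairing with \<open>n j\<close>: it is \<open>lor (n i) (n j) / lor (n j) (v j)\<close>.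
  Pairing this expansion of \<open>n i\<close> with \<open>v k\<close> gives the matrix product. This is the bridge between angles
  and lengths.\<close>
lemma gram_normals_inverse:
  assumes v: "inj v" "independent (range v)" and n: "outward_normals v n"
  shows "(\<chi> i j. lor (n i) (n j)) ** (\<chi> j k. lor (v j) (v k) / (lor (n j) (v j) * lor (n k) (v k)))
           = mat 1"
proof -
  define c where "c i = lor (n i) (v i)" for i
  have c: "c i \<noteq> 0" for i using n by (auto simp: outward_normals_def c_def less_imp_neq)
  have nv: "lor (n i) (v j) = (if i = j then c i else 0)" for i j
    using n by (auto simp: outward_normals_def c_def)
  have ni: "n i = (\<Sum>j\<in>UNIV. (lor (n i) (n j) / c j) *\<^sub>R v j)" for i
  proof -
    obtain b where b: "n i = (\<Sum>j\<in>UNIV. b j *\<^sub>R v j)"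
      using ex_combination[OF v(1) span_range_eq_UNIV[OF v], of "n i"] by blast
    have "lor (n i) (n k) = b k * c k" for k
    proof -
      have "lor (n i) (n k) = lor (n k) (\<Sum>j\<in>UNIV. b j *\<^sub>R v j)"
        by (metis b lor_commute)
      also have "\<dots> = b k * c k"
        by (simp add: lor_sum_right lor_simps nv if_distrib cong: if_cong)
      finally show ?thesis .
    qed
    then show ?thesis using b c by simp
  qed
  have "(\<Sum>j\<in>UNIV. lor (n i) (n j) * (lor (v j) (v k) / (c j * c k))) = (if i = k then 1 else 0)" for i k
  proof -
    have "(\<Sum>j\<in>UNIV. lor (n i) (n j) * (lor (v j) (v k) / (c j * c k)))
        = lor (\<Sum>j\<in>UNIV. (lor (n i) (n j) / c j) *\<^sub>R v j) (v k) / c k"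
      by (simp add: lor_sum_left lor_simps sum_divide_distrib)
    also have "\<dots> = (if i = k then 1 else 0)"
      using nv c by (simp flip: ni)
    finally show ?thesis .
  qed
  then show ?thesis
    by (simp add: vec_eq_iff matrix_matrix_mult_def mat_def c_def)
qed

section \<open>Truncated edges\<close>

definition hnormalize :: "minkowski \<Rightarrow> minkowski" where
  "hnormalize y = (1 / sqrt (- lor y y)) *\<^sub>R y"

lemma hnormalize_in_H3:
  assumes "lor y y < 0" "fst y > 0"
  shows "hnormalize y \<in> H3"
proof -
  have "sqrt (- lor y y) * sqrt (- lor y y) = - lor y y" "sqrt (- lor y y) > 0"
    using assms by auto
  then show ?thesis
    using assms by (simp add: H3_def hnormalize_def lor_simps divide_simps)
qed

lemma lor_hnormalize_eq_0 [simp]: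
  assumes "lor y y < 0"
  shows "lor (hnormalize y) u = 0 \<longleftrightarrow> lor y u = 0"
  using assms by (simp add: hnormalize_def lor_simps)

lemma hnormalize_unique:
  assumes y: "lor y y < 0" "fst y > 0" and x: "x \<in> H3" "x = t *\<^sub>R y"
  shows "x = hnormalize y"
proof -
  have "t * fst y > 0" using x by (simp add: H3_def)
  then have "t > 0" using y by (simp add: zero_less_mult_iff)
  have "t\<^sup>2 * (- lor y y) = 1"
    using x by (simp add: H3_def lor_simps power2_eq_square)
  then have "sqrt (t\<^sup>2 * (- lor y y)) = 1" by simp
  then have "t * sqrt (- lor y y) = 1"
    using \<open>t > 0\<close> unfolding real_sqrt_mult by simp
  then have "t = 1 / sqrt (- lor y y)"
    by (metis nonzero_eq_divide_eq mult_zero_right zero_neq_one)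
  then show ?thesis using x by (simp add: hnormalize_def)
qed

lemma hdist_hnormalize:
  "hdist (hnormalize x) (hnormalize y) = arcosh (- lor x y / (sqrt (- lor x x) * sqrt (- lor y y)))"
  by (simp add: hdist_def hnormalize_def lor_simps mult.commute)

lemma H3_hnormalize: "x \<in> H3 \<Longrightarrow> hnormalize x = x"
  by (simp add: H3_def hnormalize_def)

text \<open>The point where an edge leaves an ultra-ideal vertex \<open>v k\<close> is the orthogonal projection \<open>y\<close> of \<open>v l\<close> to the
  hyperplane of \<open>v k\<close>, moved to the hyperboloid. The sign of \<open>lor (v k) (v l)\<close> makes it a nonnegative combination.\<close>
lemma truncated_edge_end:
  assumes u: "lor (v k) (v k) = 1" and b: "lor (v k) (v l) \<le> 0"
    and y: "y = v l - lor (v k) (v l) *\<^sub>R v k" "lor y y < 0" "fst y > 0"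
  shows "edge_end v k l = hnormalize y" "hnormalize y \<in> segment v k l"
proof -
  have yu: "lor y (v k) = 0"
    using u by (simp add: y lor_simps lor_commute[of "v l"])
  show seg: "hnormalize y \<in> segment v k l"
  proof -
    define r where "r = 1 / sqrt (- lor y y)"
    have "r \<ge> 0" using y by (simp add: r_def)
    have "hnormalize y = (- (r * lor (v k) (v l))) *\<^sub>R v k + r *\<^sub>R v l"
      unfolding hnormalize_def r_def[symmetric] by (simp add: y(1) algebra_simps)
    moreover have "- (r * lor (v k) (v l)) \<ge> 0"
      using \<open>r \<ge> 0\<close> b by (simp add: mult_nonneg_nonpos)
    ultimately show ?thesis
      unfolding segment_def using hnormalize_in_H3[OF y(2,3)] \<open>r \<ge> 0\<close> by blast
  qed
  have "(THE x. x \<in> segment v k l \<inter> polar (v k)) = hnormalize y"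
  proof (rule the_equality)
    show "hnormalize y \<in> segment v k l \<inter> polar (v k)"
      using seg hnormalize_in_H3[OF y(2,3)] y(2) yu by (simp add: polar_def)
  next
    fix x assume "x \<in> segment v k l \<inter> polar (v k)"
    then obtain s t where x: "x \<in> H3" "x = s *\<^sub>R v k + t *\<^sub>R v l" "lor x (v k) = 0"
      by (auto simp: segment_def polar_def)
    have "s = - t * lor (v k) (v l)"
      using x(3) u by (simp add: x(2) lor_simps lor_commute[of "v l"])
    then have "x = t *\<^sub>R y" by (simp add: x(2) y(1) algebra_simps)
    then show "x = hnormalize y" using hnormalize_unique y x by blast
  qed
  then show "edge_end v k l = hnormalize y"
    using u by (simp add: edge_end_def eps_def)
qed

lemma doubly_truncatedD:
  assumes "doubly_truncated v"
  shows "inj v" "independent (range v)" "lor (v 1) (v 1) = 1" "lor (v 2) (v 2) = 1"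
    "lor (v 3) (v 3) = -1" "lor (v 4) (v 4) = -1" "fst (v 3) > 0" "fst (v 4) > 0"
    "v 3 \<in> H3" "v 4 \<in> H3"
    "\<And>i k. i \<in> {1, 2} \<Longrightarrow> k \<in> {3, 4} \<Longrightarrow> lor (v i) (v k) < 0"
    "lor (v 3) (v 4) < -1"
  using assms lor_less_minus_one[of "v 3" "v 4"] inj_eq[of v 3 4]
  by (auto simp: doubly_truncated_def H3_def)

lemma eps_doubly_truncated:
  assumes "doubly_truncated v"
  shows "eps v i = (if i \<in> {1, 2} then -1 else 1)"
  using doubly_truncatedD(3-6)[OF assms] exhaust_4[of i] by (auto simp: eps_def)

subsection \<open>Edge lengths\<close>

text \<open>Two timelike vectors with negative product lie in the same cone; this is how future-pointing
  representatives are recognized, starting from the proper vertices.\<close>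
lemma future_if_visible_from_future:
  assumes "lor y y < 0" "lor y z < 0" "z \<in> H3"
  shows "fst y > 0"
proof -
  have "lor z z < 0" "fst z > 0" using assms by (auto simp: H3_def)
  then show ?thesis
    using timelike_same_cone_iff[of y z] assms by (simp add: zero_less_mult_iff)
qed

text \<open>With \<open>b = lor (v i) (v k) < 0\<close> the cosine of the distance is \<open>sqrt (b\<^sup>2 + 1)\<close>, so that \<open>- b\<close> is its hyperbolic
  sine. This is the distance from the proper vertex to the polar plane.\<close>
lemma hdist_edge_ends_mixed:
  assumes v: "doubly_truncated v" and "i \<in> {1, 2}" "k \<in> {3, 4}"
  shows "hdist (edge_end v i k) (edge_end v k i) = arsinh (- lor (v i) (v k))"
proof -
  note D = doubly_truncatedD[OF v]
  define b where "b = lor (v i) (v k)"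
  have b: "b < 0" unfolding b_def using D(11) assms by blast
  have ii: "lor (v i) (v i) = 1" and kk: "lor (v k) (v k) = -1" and k: "v k \<in> H3"
    using D assms by auto
  define y where "y = v k - b *\<^sub>R v i"
  have yy: "lor y y = - (b\<^sup>2 + 1)" and yk: "lor y (v k) = - (b\<^sup>2 + 1)"
    unfolding y_def
    by (simp_all add: lor_simps ii kk lor_commute[of "v k" "v i"] power2_eq_square flip: b_def)
  have pos: "b\<^sup>2 + 1 > 0" by (simp add: add_nonneg_pos)
  then have "lor y y < 0" "lor y (v k) < 0" by (simp_all add: yy yk)
  then have "fst y > 0" using future_if_visible_from_future k by blast
  have "edge_end v i k = hnormalize y"
    using truncated_edge_end(1)[of v i k y] ii b y_def \<open>lor y y < 0\<close> \<open>fst y > 0\<close> by (simp add: b_def)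
  moreover have "edge_end v k i = hnormalize (v k)"
    using kk k by (simp add: edge_end_def eps_def H3_hnormalize)
  ultimately have "hdist (edge_end v i k) (edge_end v k i) = arcosh ((b\<^sup>2 + 1) / sqrt (b\<^sup>2 + 1))"
    by (simp add: hdist_hnormalize yy yk kk add.commute)
  also have "(b\<^sup>2 + 1) / sqrt (b\<^sup>2 + 1) = sqrt (b\<^sup>2 + 1)"
    using pos by (simp add: real_div_sqrt)
  also have "\<dots> = cosh (arsinh (- b))" by (simp add: cosh_arsinh_real)
  also have "arcosh \<dots> = arsinh (- b)"
    using b arsinh_real_neg_iff[of b] by (intro arcosh_cosh_real) (simp add: arsinh_minus_real less_imp_le)
  finally show ?thesis by (simp add: b_def)
qed

lemma edge_length_mixed:
  assumes "doubly_truncated v"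
  shows "edge_length v E13 = arsinh (- lor (v 1) (v 3))" "edge_length v E14 = arsinh (- lor (v 1) (v 4))"
    "edge_length v E23 = arsinh (- lor (v 2) (v 3))" "edge_length v E24 = arsinh (- lor (v 2) (v 4))"
  using hdist_edge_ends_mixed[OF assms] by (simp_all add: edge_length_def)

lemma edge_length_34:
  assumes "doubly_truncated v"
  shows "edge_length v E34 = arcosh (- lor (v 3) (v 4))"
  using doubly_truncatedD[OF assms] by (simp add: edge_length_def edge_end_def eps_def hdist_def)

lemma edge_end_12:
  assumes v: "doubly_truncated v" and c: "lor (v 1) (v 2) < -1" and "{i, k} = {1, 2}"
  shows "edge_end v i k = hnormalize (v k - lor (v 1) (v 2) *\<^sub>R v i)"
    "segment v i k \<noteq> {}"
    "lor (v k - lor (v 1) (v 2) *\<^sub>R v i) (v k - lor (v 1) (v 2) *\<^sub>R v i) = 1 - (lor (v 1) (v 2))\<^sup>2"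
proof -
  note D = doubly_truncatedD[OF v]
  define c where "c = lor (v 1) (v 2)"
  have c': "c < -1" "c = lor (v i) (v k)" and ii: "lor (v i) (v i) = 1" and kk: "lor (v k) (v k) = 1"
    and i3: "lor (v i) (v 3) < 0" and k3: "lor (v k) (v 3) < 0"
    using assms D(3,4,11) by (auto simp: c_def doubleton_eq_iff lor_commute)
  define y where "y = v k - c *\<^sub>R v i"
  have "\<bar>c\<bar> > 1" using c' by simp
  then have "c\<^sup>2 > 1" using abs_square_less_1[of c] power2_eq_1_iff[of c] by fastforce
  moreover have yy: "lor y y = 1 - c\<^sup>2"
    unfolding y_def
    by (simp add: lor_simps ii kk lor_commute[of "v k" "v i"] power2_eq_square flip: c'(2))
  ultimately have neg: "lor y y < 0" by simp
  have "lor y (v 3) < 0"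
    using i3 k3 c'(1) mult_neg_neg[of c "lor (v i) (v 3)"] by (simp add: y_def lor_simps)
  then have "fst y > 0" using future_if_visible_from_future neg D(9) by blast
  note * = truncated_edge_end[of v i k y, OF ii _ _ neg this]
  show "edge_end v i k = hnormalize (v k - lor (v 1) (v 2) *\<^sub>R v i)" "segment v i k \<noteq> {}"
    using * c' y_def by (auto simp: c_def)
  show "lor (v k - lor (v 1) (v 2) *\<^sub>R v i) (v k - lor (v 1) (v 2) *\<^sub>R v i) = 1 - (lor (v 1) (v 2))\<^sup>2"
    using yy by (simp add: y_def c_def)
qed

lemma edge_length_12:
  assumes v: "doubly_truncated v" and c: "lor (v 1) (v 2) < -1"
  shows "edge_length v E12 = arcosh (- lor (v 1) (v 2))"
proof -
  note D = doubly_truncatedD[OF v]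
  define c where "c = lor (v 1) (v 2)"
  have "c < -1" using c by (simp add: c_def)
  then have "\<bar>c\<bar> > 1" by simp
  then have c2: "c\<^sup>2 > 1" using abs_square_less_1[of c] power2_eq_1_iff[of c] by fastforce
  have "- lor (v 2 - c *\<^sub>R v 1) (v 1 - c *\<^sub>R v 2) = - c * (c\<^sup>2 - 1)"
    using D(3,4) by (simp add: lor_simps lor_commute[of "v 2" "v 1"] power2_eq_square algebra_simps flip: c_def)
  then have "edge_length v E12 = arcosh (- c * (c\<^sup>2 - 1) / (sqrt (c\<^sup>2 - 1) * sqrt (c\<^sup>2 - 1)))"
    using edge_end_12[OF v c, of 1 2] edge_end_12[OF v c, of 2 1]
    by (simp add: edge_length_def hdist_hnormalize insert_commute flip: c_def)
  also have "sqrt (c\<^sup>2 - 1) * sqrt (c\<^sup>2 - 1) = c\<^sup>2 - 1" using c2 by simp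
  also have "- c * (c\<^sup>2 - 1) / (c\<^sup>2 - 1) = - c" using c2 by simp
  finally show ?thesis by (simp add: c_def)
qed

text \<open>A point of hyperbolic space on the edge forces \<open>s\<^sup>2 + t\<^sup>2 + 2 s t lor (v 1) (v 2) = -1\<close>, which is impossible
  for \<open>lor (v 1) (v 2) \<ge> -1\<close>. Conversely \<open>v 1\<close> and \<open>v 2\<close> then span a timelike plane, whose orthogonal complement
  contains no point of hyperbolic space.\<close>
lemma mildly_truncated_iff:
  "mildly_truncated v \<longleftrightarrow> doubly_truncated v \<and> lor (v 1) (v 2) < -1"
proof (intro iffI conjI)
  assume m: "mildly_truncated v"
  then show v: "doubly_truncated v" by (simp add: mildly_truncated_def)
  note D = doubly_truncatedD[OF v]
  obtain x where "x \<in> segment v 1 2" using m by (auto simp: mildly_truncated_def)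
  then obtain s t where st: "s \<ge> 0" "t \<ge> 0" and x: "x = s *\<^sub>R v 1 + t *\<^sub>R v 2" "lor x x = -1"
    by (auto simp: segment_def H3_def)
  have "s\<^sup>2 + t\<^sup>2 + 2 * (s * t) * lor (v 1) (v 2) = -1"
    using x D(3,4) by (simp add: lor_simps lor_commute[of "v 2" "v 1"] power2_eq_square algebra_simps)
  then have "(s - t)\<^sup>2 + 2 * (s * t) * (lor (v 1) (v 2) + 1) = -1"
    by (simp add: power2_eq_square algebra_simps)
  then have "2 * (s * t) * (lor (v 1) (v 2) + 1) < 0"
    by (smt (verit) zero_le_power2)
  then show "lor (v 1) (v 2) < -1"
    using st by (smt (verit) mult_nonneg_nonneg)
next
  assume v: "doubly_truncated v \<and> lor (v 1) (v 2) < -1"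
  then have dv: "doubly_truncated v" and c: "lor (v 1) (v 2) < -1" by auto
  note D = doubly_truncatedD[OF dv]
  define c where "c = lor (v 1) (v 2)"
  have "x \<notin> polar (v 2)" if "x \<in> polar (v 1)" for x
  proof
    assume "x \<in> polar (v 2)"
    with that have x: "lor x x < 0" "lor (v 1 - c *\<^sub>R v 2) x = 0"
      by (auto simp: polar_def H3_def lor_simps lor_commute[of "v _"])
    have "lor (v 1 - c *\<^sub>R v 2) (v 1 - c *\<^sub>R v 2) < 0" 
      using edge_end_12(3)[OF dv c, of 2 1] power_strict_mono[of 1 "-c" 2] c by (simp add: c_def insert_commute)
    moreover from this have "v 1 - c *\<^sub>R v 2 \<noteq> 0" by (metis lor_simps(9) less_irrefl)
    ultimately show False
      using spacelike_if_orthogonal_to_timelike[OF x] by simp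
  qed
  then show "mildly_truncated v"
    using dv edge_end_12(2)[OF dv c, of 1 2] by (auto simp: mildly_truncated_def)
qed

subsection \<open>The new edge of a prism truncated tetrahedron\<close>

text \<open>The orthogonal projection of \<open>v k\<close> to the orthogonal complement of \<open>v 1\<close> and \<open>v 2\<close>, that is, to the plane
  whose points in hyperbolic space form the line containing the new edge.\<close>
definition foot :: "(4 \<Rightarrow> minkowski) \<Rightarrow> 4 \<Rightarrow> minkowski" where
  "foot v k =
     (let c = lor (v 1) (v 2); a = lor (v 1) (v k); b = lor (v 2) (v k)
      in v k - ((a - c * b) / (1 - c\<^sup>2)) *\<^sub>R v 1 - ((b - c * a) / (1 - c\<^sup>2)) *\<^sub>R v 2)"

lemma foot_combination: "\<exists>a b. foot v k = v k + a *\<^sub>R v 1 + b *\<^sub>R v 2"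
proof -
  have "\<exists>a b. v k - p *\<^sub>R v 1 - q *\<^sub>R v 2 = v k + a *\<^sub>R v 1 + b *\<^sub>R v 2" for p q
    by (rule exI[of _ "- p"], rule exI[of _ "- q"]) simp
  then show ?thesis by (simp only: foot_def Let_def)
qed

lemma foot_orthogonal:
  assumes "lor (v 1) (v 1) = 1" "lor (v 2) (v 2) = 1" "\<bar>lor (v 1) (v 2)\<bar> < 1"
  shows "lor (foot v k) (v 1) = 0" "lor (foot v k) (v 2) = 0"
proof -
  define c a b where "c = lor (v 1) (v 2)" and "a = lor (v 1) (v k)" and "b = lor (v 2) (v k)"
  have "1 - c\<^sup>2 \<noteq> 0" using assms(3) abs_square_less_1[of c] by (simp add: c_def)
  moreover have "foot v k = v k - ((a - c * b) / (1 - c\<^sup>2)) *\<^sub>R v 1 - ((b - c * a) / (1 - c\<^sup>2)) *\<^sub>R v 2"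
    by (simp add: foot_def c_def a_def b_def Let_def)
  ultimately show "lor (foot v k) (v 1) = 0" "lor (foot v k) (v 2) = 0"
    using assms(1,2) lor_commute[of "v k"] lor_commute[of "v 2" "v 1"]
    by (simp_all add: lor_simps flip: c_def a_def b_def)
      (simp_all add: divide_simps power2_eq_square algebra_simps)
qed

lemma combination_eq_0_if_orthogonal:
  assumes "lor u u = 1" "lor w w = 1" "\<bar>lor u w\<bar> < 1"
    and "x = a *\<^sub>R u + b *\<^sub>R w" "lor x u = 0" "lor x w = 0"
  shows "x = 0"
proof -
  define c where "c = lor u w"
  have "a + b * c = 0" "a * c + b = 0"
    using assms lor_commute[of w u] by (simp_all add: lor_simps c_def)
  moreover from this have "b * (1 - c\<^sup>2) = 0"
    by (simp add: eq_neg_iff_add_eq_0[symmetric] power2_eq_square algebra_simps)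
  moreover have "1 - c\<^sup>2 \<noteq> 0" using assms(3) abs_square_less_1[of c] by (simp add: c_def)
  ultimately have "b = 0" "a = 0" by auto
  then show ?thesis using assms by simp
qed

text \<open>For \<open>\<bar>lor (v 1) (v 2)\<bar> < 1\<close> the form is positive definite on the span of \<open>v 1\<close> and \<open>v 2\<close>, so the projection can only
  decrease the square of \<open>v k\<close>.\<close>
lemma foot_timelike:
  assumes v: "doubly_truncated v" and c: "\<bar>lor (v 1) (v 2)\<bar> < 1" and "k \<in> {3, 4}"
  shows "lor (foot v k) (foot v k) < 0" "fst (foot v k) > 0"
proof -
  note D = doubly_truncatedD[OF v]
  note orth = foot_orthogonal[OF D(3,4) c]
  obtain a b where ab: "foot v k = v k + a *\<^sub>R v 1 + b *\<^sub>R v 2"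
    using foot_combination by blast
  have k: "v k \<in> H3" "lor (v k) (v k) = -1" using assms(3) D by auto
  define z where "z = a *\<^sub>R v 1 + b *\<^sub>R v 2"
  have "lor z z = (a + b * lor (v 1) (v 2))\<^sup>2 + b\<^sup>2 * (1 - (lor (v 1) (v 2))\<^sup>2)"
    using D(3,4) by (simp add: z_def lor_simps lor_commute[of "v 2" "v 1"] power2_eq_square algebra_simps)
  moreover have "1 - (lor (v 1) (v 2))\<^sup>2 > 0" using c by (simp add: abs_square_less_1)
  ultimately have zz: "lor z z \<ge> 0" by simp
  have fz: "lor (foot v k) z = 0" using orth by (simp add: z_def lor_simps)
  have vk: "v k = foot v k - z" using ab by (simp add: z_def)
  have "lor (foot v k - z) (foot v k - z) = lor (foot v k) (foot v k) + lor z z"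
    using fz lor_commute[of z "foot v k"] by (simp add: lor_simps)
  then show neg: "lor (foot v k) (foot v k) < 0" using zz k by (simp flip: vk)
  have "lor (foot v k) (foot v k - z) = lor (foot v k) (foot v k)"
    using fz by (simp add: lor_simps)
  then have "lor (foot v k) (v k) = lor (foot v k) (foot v k)" by (simp flip: vk)
  then show "fst (foot v k) > 0"
    using future_if_visible_from_future[OF neg _ k(1)] neg by simp
qed

text \<open>A common point of the polar planes is a timelike vector orthogonal to \<open>v 1 + v 2\<close> and \<open>v 1 - v 2\<close>, which are then
  spacelike. Conversely the foot of a proper vertex gives such a point.\<close>
lemma prism_truncated_iff:
  "prism_truncated v \<longleftrightarrow> doubly_truncated v \<and> \<bar>lor (v 1) (v 2)\<bar> < 1"
proof (intro iffI conjI)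
  assume p: "prism_truncated v"
  then show v: "doubly_truncated v" by (simp add: prism_truncated_def)
  note D = doubly_truncatedD[OF v]
  obtain x where "x \<in> polar (v 1)" "x \<in> polar (v 2)"
    using p by (auto simp: prism_truncated_def)
  then have x: "lor x x < 0" "lor (v 1) x = 0" "lor (v 2) x = 0"
    by (auto simp: polar_def H3_def lor_commute[of "v _"])
  have "lor (v 1 + v 2) (v 3) < 0"
    using D(11)[of 1 3] D(11)[of 2 3] by (simp add: lor_simps)
  then have "v 1 + v 2 \<noteq> 0"
    by (metis bilinear_lzero[OF bilinear_lor] less_irrefl)
  then have "lor (v 1 + v 2) (v 1 + v 2) > 0"
    using x by (intro spacelike_if_orthogonal_to_timelike[OF x(1)]) (simp_all add: lor_simps)
  moreover have "v 1 - v 2 \<noteq> 0" using inj_eq[OF D(1), of 1 2] by simp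
  then have "lor (v 1 - v 2) (v 1 - v 2) > 0"
    using x by (intro spacelike_if_orthogonal_to_timelike[OF x(1)]) (simp_all add: lor_simps)
  ultimately show "\<bar>lor (v 1) (v 2)\<bar> < 1"
    using D(3,4) by (simp add: lor_simps lor_commute[of "v 2" "v 1"])
next
  assume "doubly_truncated v \<and> \<bar>lor (v 1) (v 2)\<bar> < 1"
  then have v: "doubly_truncated v" and c: "\<bar>lor (v 1) (v 2)\<bar> < 1" by auto
  have "hnormalize (foot v 3) \<in> polar (v 1) \<inter> polar (v 2)"
    using foot_orthogonal[OF _ _ c] foot_timelike[OF v c] doubly_truncatedD[OF v]
    by (simp add: polar_def hnormalize_in_H3)
  then show "prism_truncated v" using v by (auto simp: prism_truncated_def)
qed

text \<open>The face opposite to \<open>v i\<close> is spanned by \<open>v 1\<close>, \<open>v 2\<close> and \<open>v k\<close>; modulo \<open>v 1\<close> and \<open>v 2\<close> it contains only multiples of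
  \<open>v k\<close>, so the projection of \<open>v k\<close> is the only candidate.\<close>
lemma new_edge_end:
  assumes v: "doubly_truncated v" and c: "\<bar>lor (v 1) (v 2)\<bar> < 1" and ik: "{i, k} = {3, 4}"
  shows "new_edge_end v i = hnormalize (foot v k)"
  unfolding new_edge_end_def
proof (rule the_equality)
  note D = doubly_truncatedD[OF v]
  note orth = foot_orthogonal[OF D(3,4) c]
  have k: "k \<in> {3, 4}" using ik by auto
  note tl = foot_timelike[OF v c k]
  obtain a b where ab: "foot v k = v k + a *\<^sub>R v 1 + b *\<^sub>R v 2"
    using foot_combination by blast
  have vs: "v ` (- {i}) = {v 1, v 2, v k}"
  proof -
    have "x \<in> - {i} \<longleftrightarrow> x \<in> {1, 2, k}" for x
      using exhaust_4[of x] ik by (auto simp: doubleton_eq_iff)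
    then have "- {i} = {1, 2, k}" by blast
    then show ?thesis by simp
  qed
  have "foot v k \<in> span (v ` (- {i}))"
    unfolding vs ab by (intro span_add span_scale span_base) auto
  then have "hnormalize (foot v k) \<in> span (v ` (- {i}))"
    unfolding hnormalize_def by (rule span_scale)
  then show "hnormalize (foot v k) \<in> polar (v 1) \<inter> polar (v 2) \<inter> face_plane v i"
    using hnormalize_in_H3[OF tl] tl orth by (simp add: polar_def face_plane_def)
  fix x assume "x \<in> polar (v 1) \<inter> polar (v 2) \<inter> face_plane v i"
  then have x: "x \<in> H3" "lor x (v 1) = 0" "lor x (v 2) = 0" "x \<in> span {v k, v 1, v 2}"
    by (auto simp: polar_def face_plane_def vs insert_commute)
  obtain t where "x - t *\<^sub>R v k \<in> span {v 1, v 2}"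
    using x(4) by (auto simp: span_breakdown_eq)
  then obtain p q where "x - t *\<^sub>R v k - p *\<^sub>R v 1 = q *\<^sub>R v 2"
    by (auto simp: span_breakdown_eq span_singleton)
  then have "x = t *\<^sub>R v k + p *\<^sub>R v 1 + q *\<^sub>R v 2"
    by (simp add: algebra_simps)
  then have "x - t *\<^sub>R foot v k = (p - t * a) *\<^sub>R v 1 + (q - t * b) *\<^sub>R v 2"
    by (simp add: ab algebra_simps)
  moreover have "lor (x - t *\<^sub>R foot v k) (v 1) = 0" "lor (x - t *\<^sub>R foot v k) (v 2) = 0"
    using x orth by (simp_all add: lor_simps)
  ultimately have "x - t *\<^sub>R foot v k = 0"
    using combination_eq_0_if_orthogonal[OF D(3,4) c] by blast
  then show "x = hnormalize (foot v k)"
    using hnormalize_unique[OF tl x(1), of t] by simp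
qed

text \<open>Both sides are orthogonal to \<open>v 1\<close> and \<open>v 2\<close> and have the same products with \<open>n i\<close> and \<open>n j\<close>. This puts the normals
  of the two faces at the ends of the new edge and the end points themselves into one plane.\<close>
lemma normal_eq_combination_of_feet:
  assumes v: "doubly_truncated v" and c: "\<bar>lor (v 1) (v 2)\<bar> < 1" and ij: "{i, j} = {3, 4}"
    and n: "outward_normals v n"
  shows "n i = (1 / lor (n i) (v i)) *\<^sub>R foot v i + (lor (n i) (n j) / lor (n j) (v j)) *\<^sub>R foot v j"
    (is "_ = ?r")
proof -
  note D = doubly_truncatedD[OF v]
  note orth = foot_orthogonal[OF D(3,4) c]
  have N: "lor (n a) (n a) = 1" "b \<noteq> a \<Longrightarrow> lor (n a) (v b) = 0" "lor (n a) (v a) \<noteq> 0" for a b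
    using n by (auto simp: outward_normals_def less_imp_neq)
  have ij': "i \<in> {3,4}" "j \<in> {3,4}" "i \<noteq> j" using ij by (auto simp: doubleton_eq_iff)
  have foot: "lor (n a) (foot v b) = lor (n a) (v b)" if "a \<in> {3,4}" for a b
  proof -
    obtain p q where "foot v b = v b + p *\<^sub>R v 1 + q *\<^sub>R v 2" using foot_combination by blast
    then show ?thesis using that N(2)[of 1 a] N(2)[of 2 a] by (auto simp: lor_simps)
  qed
  define z where "z = n i - ?r"
  have nz: "lor (n i) z = 0" "lor (n j) z = 0"
    using ij' N(1,2,3) foot lor_commute[of "n j" "n i"] by (auto simp: z_def lor_simps)
  have vz: "lor z (v 1) = 0" "lor z (v 2) = 0"
    using ij' N(2)[of 1 i] N(2)[of 2 i] orth by (auto simp: z_def lor_simps)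
  obtain b where b: "z = (\<Sum>a\<in>UNIV. b a *\<^sub>R v a)"
    using ex_combination[OF D(1) span_range_eq_UNIV[OF D(1,2)], of z] by blast
  have "lor (n a) z = b a * lor (n a) (v a)" for a
  proof -
    have "lor (n a) z = (\<Sum>d\<in>UNIV. if d = a then b a * lor (n a) (v a) else 0)"
      unfolding b lor_sum_right lor_simps by (intro sum.cong) (auto simp: N(2))
    then show ?thesis by simp
  qed
  then have "b 3 = 0" "b 4 = 0" using nz N(3) ij' by auto
  then have "z = b 1 *\<^sub>R v 1 + b 2 *\<^sub>R v 2" using b by (simp add: sum_4)
  then have "z = 0" using combination_eq_0_if_orthogonal[OF D(3,4) c _ vz] by blast
  then show ?thesis by (simp add: z_def)
qed

text \<open>The normal of one face is orthogonal to the foot lying on that face. Expanding it by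
  \<open>normal_eq_combination_of_feet\<close> gives two linear relations between \<open>lor (n 3) (n 4)\<close> and the products of the feet;
  their product determines the square of \<open>lor (n 3) (n 4)\<close>, and its sign is negative since the feet are
  timelike vectors in the same cone.\<close>
lemma new_edge_length:
  assumes v: "prism_truncated v" and n: "outward_normals v n"
  shows "lor (n 3) (n 4) < 0" "new_edge_length v = arcosh (- lor (n 3) (n 4))"
proof -
  have dv: "doubly_truncated v" and c: "\<bar>lor (v 1) (v 2)\<bar> < 1"
    using v by (simp_all add: prism_truncated_iff)
  note tl3 = foot_timelike[OF dv c, of 3, simplified]
  note tl4 = foot_timelike[OF dv c, of 4, simplified]
  define g x33 x34 x44 c3 c4 where "g = lor (n 3) (n 4)" and "x33 = lor (foot v 3) (foot v 3)"
    and "x34 = lor (foot v 3) (foot v 4)" and "x44 = lor (foot v 4) (foot v 4)"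
    and "c3 = lor (n 3) (v 3)" and "c4 = lor (n 4) (v 4)"
  have neg: "x33 < 0" "x44 < 0" "c3 < 0" "c4 < 0"
    using tl3 tl4 n by (simp_all add: x33_def x44_def c3_def c4_def outward_normals_def)
  have "x34 < 0"
    using timelike_same_cone_iff[OF tl3(1) tl4(1)] tl3(2) tl4(2) by (simp add: x34_def)
  have nf: "lor (n i) (foot v j) = 0" if "{i, j} = {3, 4}" for i j
  proof -
    have N: "b \<noteq> i \<Longrightarrow> lor (n i) (v b) = 0" for b using n by (simp add: outward_normals_def)
    obtain p q where "foot v j = v j + p *\<^sub>R v 1 + q *\<^sub>R v 2" using foot_combination by blast
    then show ?thesis using that N[of 1] N[of 2] N[of j] by (auto simp: lor_simps doubleton_eq_iff)
  qed
  have "lor (n 3) (foot v 4) = x34 / c3 + g / c4 * x44"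
    by (subst normal_eq_combination_of_feet[OF dv c _ n, of 3 4])
      (simp_all add: lor_simps x34_def x44_def g_def c3_def c4_def)
  then have "x34 / c3 + g / c4 * x44 = 0" using nf[of 3 4] by simp
  then have e1: "x34 * c4 = - g * c3 * x44" using neg by (simp add: field_simps)
  have "lor (n 4) (foot v 3) = x34 / c4 + g / c3 * x33"
    by (subst normal_eq_combination_of_feet[OF dv c _ n, of 4 3])
      (simp_all add: lor_simps x34_def x33_def g_def c3_def c4_def insert_commute
        lor_commute[of "foot v 4" "foot v 3"] lor_commute[of "n 4" "n 3"])
  then have "x34 / c4 + g / c3 * x33 = 0" using nf[of 4 3] by (simp add: insert_commute)
  then have e2: "x34 * c3 = - g * c4 * x33" using neg by (simp add: field_simps)
  have "x34 * c4 > 0" "c3 * x44 > 0" using neg \<open>x34 < 0\<close> by (simp_all add: mult_neg_neg)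
  then have "g < 0" using e1 by (smt (verit) mult.assoc mult_nonneg_nonneg mult_minus_left)
  then show "lor (n 3) (n 4) < 0" by (simp add: g_def)
  have "(x34 * c4) * (x34 * c3) = (- g * c3 * x44) * (- g * c4 * x33)"
    using e1 e2 by simp
  then have "(c3 * c4) * x34\<^sup>2 = (c3 * c4) * (g\<^sup>2 * (x33 * x44))"
    by (simp add: power2_eq_square algebra_simps)
  then have "x34\<^sup>2 = g\<^sup>2 * (x33 * x44)" using neg by simp
  then have "sqrt (x34\<^sup>2) = sqrt (g\<^sup>2 * ((- x33) * (- x44)))" by simp
  then have "- x34 = - g * (sqrt (- x33) * sqrt (- x44))"
    using \<open>x34 < 0\<close> \<open>g < 0\<close> unfolding real_sqrt_mult by simp
  then have "- x34 / (sqrt (- x33) * sqrt (- x44)) = - g"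
    using neg by simp
  then have "hdist (hnormalize (foot v 3)) (hnormalize (foot v 4)) = arcosh (- g)"
    unfolding hdist_hnormalize x33_def x34_def x44_def by simp
  then have "hdist (hnormalize (foot v 4)) (hnormalize (foot v 3)) = arcosh (- g)"
    by (simp add: hdist_def lor_commute)
  then show "new_edge_length v = arcosh (- lor (n 3) (n 4))"
    using new_edge_end[OF dv c, of 3 4] new_edge_end[OF dv c, of 4 3]
    by (simp add: new_edge_length_def g_def insert_commute)
qed

section \<open>Edges of the tetrahedron\<close>

lemma UNIV_edge: "UNIV = {E12, E34, E13, E23, E24, E14}"
  using edge.exhaust by auto

lemma verts_inject: "verts e = verts f \<longleftrightarrow> e = f"
  by (cases e; cases f) (simp_all add: verts_def doubleton_eq_iff)

lemma edge_joining_eq: "verts e = {k, l} \<Longrightarrow> edge_joining k l = e"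
  unfolding edge_joining_def by (rule the_equality) (auto simp flip: verts_inject)

lemma edge_joining_commute: "edge_joining k l = edge_joining l k"
  by (simp add: edge_joining_def insert_commute)

lemma edge_joining_ends: "ends e = (k, l) \<Longrightarrow> edge_joining k l = e"
  by (rule edge_joining_eq) (simp add: verts_def)

lemma edge_joining_simps [simp]:
  "edge_joining 1 2 = E12" "edge_joining 3 4 = E34" "edge_joining 1 3 = E13"
  "edge_joining 2 3 = E23" "edge_joining 2 4 = E24" "edge_joining 1 4 = E14"
  "edge_joining 2 1 = E12" "edge_joining 4 3 = E34" "edge_joining 3 1 = E13"
  "edge_joining 3 2 = E23" "edge_joining 4 2 = E24" "edge_joining 4 1 = E14"
  by (rule edge_joining_eq; simp add: verts_def insert_commute)+

lemma verts_edge_joining: "k \<noteq> l \<Longrightarrow> verts (edge_joining k l) = {k, l}"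
  using exhaust_4[of k] exhaust_4[of l] by (auto simp: verts_def)

lemma ends_distinct:
  assumes "ends e = (i, j)" "ends (opposite e) = (k, l)"
  shows "distinct [i, j, k, l]"
  using assms by (cases e) auto

lemma opposite_opposite [simp]: "opposite (opposite e) = e"
  by (cases e) auto

lemma verts_opposite: "verts (opposite e) = - verts e"
proof -
  have "x \<in> verts (opposite e) \<longleftrightarrow> x \<in> - verts e" for x
    using exhaust_4[of x] by (cases e) (auto simp: verts_def)
  then show ?thesis by blast
qed

lemma Compl_pair_4:
  assumes "distinct [i, j, k, l :: 4]"
  shows "- {i, j} = {k, l}"
proof -
  have "card {i, j, k, l} = card (UNIV :: 4 set)" using assms by simp
  then have "{i, j, k, l} = UNIV" by (intro card_subset_eq) auto
  then show ?thesis using assms by auto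
qed

lemma opposite_edge_joining:
  assumes "distinct [i, j, k, l]"
  shows "opposite (edge_joining i j) = edge_joining k l"
proof -
  have "verts (opposite (edge_joining i j)) = verts (edge_joining k l)"
    using assms by (simp add: verts_opposite verts_edge_joining Compl_pair_4)
  then show ?thesis by (simp add: verts_inject)
qed

lemma sum_4_distinct:
  fixes f :: "4 \<Rightarrow> 'a::comm_monoid_add"
  assumes "distinct [i, j, k, l]"
  shows "sum f UNIV = f i + f j + f k + f l"
proof -
  have "UNIV = {i, j} \<union> - {i, j}" by blast
  also have "\<dots> = {i, j, k, l}" unfolding Compl_pair_4[OF assms] by auto
  finally have "sum f UNIV = sum f {i, j, k, l}" by simp
  then show ?thesis using assms by (simp add: add.assoc)
qed

lemma prod_4_distinct:
  fixes f :: "4 \<Rightarrow> 'a::comm_monoid_mult"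
  assumes "distinct [i, j, k, l]"
  shows "prod f UNIV = f i * f j * f k * f l"
proof -
  have "UNIV = {i, j} \<union> - {i, j}" by blast
  also have "\<dots> = {i, j, k, l}" unfolding Compl_pair_4[OF assms] by auto
  finally have "prod f UNIV = prod f {i, j, k, l}" by simp
  then show ?thesis using assms by (simp add: mult.assoc)
qed

lemma edge_joining_eq_iff:
  assumes "i \<noteq> j" "k \<noteq> l"
  shows "edge_joining i j = edge_joining k l \<longleftrightarrow> {i, j} = {k, l}"
  using assms by (simp add: verts_edge_joining flip: verts_inject)

lemma edge_joining_enumeration:
  assumes d: "distinct [i, j, k, l]"
  defines "es \<equiv> [edge_joining i j, edge_joining k l, edge_joining i k, edge_joining j l,
    edge_joining i l, edge_joining j k]"
  shows "distinct es" "set es = UNIV"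
proof -
  show dist: "distinct es"
    using d by (auto simp: es_def edge_joining_eq_iff doubleton_eq_iff)
  have "card (set es) = card (UNIV :: edge set)"
    unfolding distinct_card[OF dist] by (simp add: UNIV_edge es_def)
  then show "set es = UNIV" by (intro card_subset_eq) auto
qed

lemma sum_edge_distinct:
  fixes f :: "edge \<Rightarrow> 'a::comm_monoid_add"
  assumes "distinct [i, j, k, l]"
  shows "sum f UNIV = f (edge_joining i j) + f (edge_joining k l) + f (edge_joining i k)
    + f (edge_joining j l) + f (edge_joining i l) + f (edge_joining j k)"
proof -
  note es = edge_joining_enumeration[OF assms]
  show ?thesis
    unfolding es(2)[symmetric] sum.distinct_set_conv_list[OF es(1)] by (simp add: add.assoc)
qed

lemma adjacent_edges_cases:
  assumes "f \<noteq> e" "f \<noteq> opposite e"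
  obtains i j k l where "distinct [i, j, k, l]" "e = edge_joining i j" "f = edge_joining j l"
proof -
  obtain i j where e: "ends e = (i, j)" by fastforce
  obtain k l where o: "ends (opposite e) = (k, l)" by fastforce
  have d: "distinct [i, j, k, l]" using e o by (rule ends_distinct)
  have eq: "e = edge_joining i j" "e = edge_joining j i" "opposite e = edge_joining k l"
    using edge_joining_ends[OF e] edge_joining_ends[OF o] by (simp_all add: edge_joining_commute)
  have "f \<in> {edge_joining i k, edge_joining j l, edge_joining i l, edge_joining j k}"
    using edge_joining_enumeration(2)[OF d] assms eq by auto
  then consider "f = edge_joining i k" | "f = edge_joining j l" | "f = edge_joining i l" | "f = edge_joining j k"
    by blast
  then show thesis
  proof cases
    case 1 show ?thesis by (rule that[of j i l k]) (use d eq 1 in auto)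
  next
    case 2 show ?thesis by (rule that[of i j k l]) (use d eq 2 in auto)
  next
    case 3 show ?thesis by (rule that[of j i k l]) (use d eq 3 in auto)
  next
    case 4 show ?thesis by (rule that[of i j l k]) (use d eq 4 in auto)
  qed
qed

lemma the_common_vertex:
  assumes "distinct [i, j, k, l]"
  shows "(THE x. x \<in> verts (edge_joining i j) \<inter> verts (edge_joining j l)) = j"
    "(THE x. x \<notin> verts (edge_joining i j) \<union> verts (edge_joining j l)) = k"
proof -
  have v: "verts (edge_joining i j) = {i, j}" "verts (edge_joining j l) = {j, l}"
    using assms by (auto simp: verts_edge_joining)
  show "(THE x. x \<in> verts (edge_joining i j) \<inter> verts (edge_joining j l)) = j"
    unfolding v using assms by (intro the_equality) auto
  have "x \<notin> {i, j} \<Longrightarrow> x = k \<or> x = l" for x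
    using Compl_pair_4[OF assms] by blast
  then show "(THE x. x \<notin> verts (edge_joining i j) \<union> verts (edge_joining j l)) = k"
    unfolding v using assms by (intro the_equality) auto
qed

section \<open>The derivative of the inverse matrix\<close>

lemma differentiable_det:
  fixes A :: "'a::real_normed_vector \<Rightarrow> real^'n^'n::finite"
  assumes "\<And>i j. (\<lambda>x. A x $ i $ j) differentiable (at p)"
  shows "(\<lambda>x. det (A x)) differentiable (at p)"
proof -
  have "(\<lambda>x. \<Prod>i\<in>UNIV. A x $ i $ s i) differentiable (at p)" for s :: "'n \<Rightarrow> 'n"
  proof -
    have "((\<lambda>x. \<Prod>i\<in>UNIV. A x $ i $ s i) has_derivative
      (\<lambda>h. \<Sum>i\<in>UNIV. frechet_derivative (\<lambda>x. A x $ i $ s i) (at p) h * (\<Prod>j\<in>UNIV - {i}. A p $ j $ s j)))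
      (at p)"
      by (intro has_derivative_prod) (use assms frechet_derivative_works in blast)
    then show ?thesis unfolding differentiable_def by blast
  qed
  then show ?thesis
    unfolding det_def by (intro differentiable_sum differentiable_mult) (auto intro: finite_permutations)
qed

lemma differentiable_cramer_inverse:
  fixes A :: "'a::real_normed_vector \<Rightarrow> real^'n^'n::finite"
  assumes A: "\<And>i j. (\<lambda>x. A x $ i $ j) differentiable (at p)" and "det (A p) \<noteq> 0"
  shows "(\<lambda>x. cramer_inverse (A x) $ k $ l) differentiable (at p)"
proof -
  have "(\<lambda>x. det (\<chi> i j. if j = k then axis l 1 $ i else A x $ i $ j)) differentiable (at p)"
  proof (rule differentiable_det)
    fix i j
    show "(\<lambda>x. (\<chi> i j. if j = k then axis l 1 $ i else A x $ i $ j) $ i $ j) differentiable (at p)"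
      using A by (cases "j = k") simp_all
  qed
  then show ?thesis
    using assms differentiable_det[OF A]
    by (simp add: cramer_inverse_def differentiable_divide)
qed

text \<open>The inverse is differentiable by Cramer's rule, so its derivative \<open>dM\<close> can be read off from \<open>A M = 1\<close>: one
  has \<open>dA M + A dM = 0\<close>, that is, \<open>dM = - M dA M\<close>.\<close>
lemma has_derivative_cramer_inverse:
  fixes A :: "'a::real_normed_vector \<Rightarrow> real^'n^'n::finite"
  assumes A: "\<And>i j. ((\<lambda>x. A x $ i $ j) has_derivative A' i j) (at p)" and nz: "det (A p) \<noteq> 0"
  defines "M \<equiv> cramer_inverse (A p)"
  shows "((\<lambda>x. cramer_inverse (A x) $ k $ l) has_derivative
      (\<lambda>h. - (\<Sum>i\<in>UNIV. \<Sum>j\<in>UNIV. M $ k $ i * A' i j h * M $ j $ l))) (at p)"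
proof -
  let ?C = "\<lambda>x. cramer_inverse (A x)"
  have dA: "\<And>i j. (\<lambda>x. A x $ i $ j) differentiable (at p)"
    using A unfolding differentiable_def by blast
  define M' where "M' i j = frechet_derivative (\<lambda>x. ?C x $ i $ j) (at p)" for i j
  have M': "((\<lambda>x. ?C x $ i $ j) has_derivative M' i j) (at p)" for i j
    unfolding M'_def using differentiable_cramer_inverse[OF dA nz]
    by (rule frechet_derivative_works[THEN iffD1])
  have "isCont (\<lambda>x. det (A x)) p"
    using differentiable_det[OF dA] by (rule differentiable_imp_continuous_within)
  then have "((\<lambda>x. det (A x)) \<longlongrightarrow> det (A p)) (at p)" by (simp add: isCont_def)
  then have ev: "\<forall>\<^sub>F x in at p. det (A x) \<noteq> 0"
    using nz by (rule tendsto_imp_eventually_ne)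
  have eq: "(\<Sum>j\<in>UNIV. A' i j h * M $ j $ l + A p $ i $ j * M' j l h) = 0" for i l h
  proof -
    let ?f = "\<lambda>x. \<Sum>j\<in>UNIV. A x $ i $ j * ?C x $ j $ l"
    have f: "?f x = mat 1 $ i $ l" if "det (A x) \<noteq> 0" for x
      using cramer_inverse[OF that] by (simp add: matrix_matrix_mult_def vec_eq_iff)
    have "(?f has_derivative (\<lambda>h. \<Sum>j\<in>UNIV. A p $ i $ j * M' j l h + A' i j h * M $ j $ l)) (at p)"
      unfolding M_def by (intro has_derivative_sum has_derivative_mult A M')
    moreover have "((\<lambda>x. mat 1 $ i $ l :: real) has_derivative (\<lambda>h. 0)) (at p)" by simp
    then have "(?f has_derivative (\<lambda>h. 0)) (at p)"
      by (rule has_derivative_transform_eventually)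
        (use ev in eventually_elim, simp_all add: f nz)
    ultimately have "(\<lambda>h. \<Sum>j\<in>UNIV. A p $ i $ j * M' j l h + A' i j h * M $ j $ l) = (\<lambda>h. 0)"
      by (rule has_derivative_unique)
    then show ?thesis by (simp add: fun_eq_iff add.commute)
  qed
  have "M' k l h = - (\<Sum>i\<in>UNIV. \<Sum>j\<in>UNIV. M $ k $ i * A' i j h * M $ j $ l)" for h
  proof -
    define X Y where "X = (\<chi> i j. A' i j h)" and "Y = (\<chi> i j. M' i j h)"
    have "A p ** M = mat 1" unfolding M_def using nz by (rule cramer_inverse)
    then have MA: "M ** A p = mat 1" by (rule matrix_left_right_inverse[THEN iffD1])
    have "X ** M + A p ** Y = 0"
      using eq by (simp add: vec_eq_iff X_def Y_def matrix_matrix_mult_def sum.distrib)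
    then have "M ** (X ** M + A p ** Y) = 0"
      by (simp add: vec_eq_iff matrix_matrix_mult_def)
    then have "M ** (X ** M) + M ** (A p ** Y) = 0"
      by (simp add: matrix_add_ldistrib)
    then have "Y = - (M ** (X ** M))"
      by (simp add: matrix_mul_assoc MA eq_neg_iff_add_eq_0 add.commute)
    then have "Y $ k $ l = - (M ** (X ** M)) $ k $ l" by simp
    then show ?thesis
      by (simp add: X_def Y_def matrix_matrix_mult_def sum_distrib_left mult.assoc)
  qed
  then have "M' k l = (\<lambda>h. - (\<Sum>i\<in>UNIV. \<Sum>j\<in>UNIV. M $ k $ i * A' i j h * M $ j $ l))" by blast
  then show ?thesis using M'[of k l] by simp
qed

section \<open>The derivative of the lengths with respect to the angles\<close>

text \<open>The common diagonal of all vertex Gram matrices; \<open>- delta i\<close> is the sign \<open>\<epsilon>\<^sub>i\<close> of the vertex.\<close>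
definition delta :: "4 \<Rightarrow> real" where
  "delta i = (if i \<in> {1, 2} then 1 else -1)"

lemma delta_cases: "delta i = 1 \<or> delta i = -1"
  by (simp add: delta_def)

lemma delta_mult_self [simp]: "delta i * delta i = 1" "delta i * (delta i * x) = x"
  by (simp_all add: delta_def)

text \<open>The sign picked up by passing between trigonometric and hyperbolic functions at \<open>e\<^sub>1\<^sub>2\<close>. Throughout, the
  flag \<open>prism\<close> selects the prism truncated case.\<close>
definition kappa :: "bool \<Rightarrow> edge \<Rightarrow> real" where
  "kappa prism e = (if prism \<and> e = E12 then -1 else 1)"

lemma kappa_mult_self [simp]: "kappa prism e * kappa prism e = 1" "kappa prism e * (kappa prism e * x) = x"
  by (simp_all add: kappa_def)

text \<open>In the prism truncated case the coordinate \<open>E12\<close> of \<open>x\<close> is the length of the new edge, between the faces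
  opposite to the vertices 3 and 4.\<close>
definition face_gram :: "bool \<Rightarrow> real^edge \<Rightarrow> real^4^4" where
  "face_gram prism x = (\<chi> i j. if i = j then 1 else
     let e = opposite (edge_joining i j) in - (if prism \<and> e = E12 then cosh (x $ e) else cos (x $ e)))"

definition vertex_gram :: "real^4^4 \<Rightarrow> 4 \<Rightarrow> 4 \<Rightarrow> real" where
  "vertex_gram G i j =
     (let M = cramer_inverse G
      in M $ i $ j / (sqrt (delta i * M $ i $ i) * sqrt (delta j * M $ j $ j)))"

definition length_of :: "bool \<Rightarrow> edge \<Rightarrow> real \<Rightarrow> real" where
  "length_of prism e h =
     (if e = E12 \<and> prism then arccos h else if e \<in> {E12, E34} then arcosh h else arsinh h)"

definition length_map :: "bool \<Rightarrow> real^edge \<Rightarrow> real^edge" where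
  "length_map prism x =
     (\<chi> e. length_of prism e (- vertex_gram (face_gram prism x) (fst (ends e)) (snd (ends e))))"

definition Smat_real :: "(4 \<Rightarrow> 4 \<Rightarrow> real) \<Rightarrow> edge \<Rightarrow> edge \<Rightarrow> real" where
  "Smat_real H e f =
     (if f = e then
        (case (ends e, ends (opposite e)) of ((k, m), (i, j)) \<Rightarrow>
          (- H i k * H j m + delta m * H i m * H j m * H k m
           - H i m * H j k + delta k * H i k * H j k * H k m) / ((H k m)\<^sup>2 - delta k * delta m))
      else if f = opposite e then 1
      else let k = (THE k. k \<in> verts e \<inter> verts f); j = (THE j. j \<notin> verts e \<union> verts f)
           in delta k * H j k)"

text \<open>A point \<open>a\<close> of the space of angles together with the vertex Gram matrix \<open>H\<close> of a tetrahedron having these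
  angles. The \<open>d\<close> are the factors relating \<open>H\<close> to the inverse of the face Gram matrix. This is all the
  geometry that enters the computation of the derivative.\<close>
locale gram_point =
  fixes prism :: bool and a :: "real^edge" and H :: "4 \<Rightarrow> 4 \<Rightarrow> real" and d :: "4 \<Rightarrow> real"
  assumes H_commute: "H i j = H j i"
    and H_diag: "H i i = delta i"
    and d_pos: "d i > 0"
    and inverse: "face_gram prism a ** (\<chi> i j. H i j * d i * d j) = mat 1"
    and det_neg: "det (face_gram prism a) < 0"
    and H12: "if prism then \<bar>H 1 2\<bar> < 1 else H 1 2 < -1"
    and H34: "H 3 4 < -1"
    and H_mixed: "i \<in> {1, 2} \<Longrightarrow> k \<in> {3, 4} \<Longrightarrow> H i k < 0"
    and a_pos: "a $ e > 0"
    and a_less_pi: "\<not> (prism \<and> e = E12) \<Longrightarrow> a $ e < pi"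
begin

lemma cramer_inverse_eq: "cramer_inverse (face_gram prism a) = (\<chi> i j. H i j * d i * d j)"
  using inverse by (rule cramer_inverse_unique)

lemma sqrt_diag: "sqrt (delta i * (H i i * d i * d i)) = d i"
proof -
  have "delta i * (H i i * d i * d i) = (d i)\<^sup>2"
    by (simp add: H_diag power2_eq_square mult.assoc)
  then show ?thesis using d_pos[of i] by simp
qed

lemma vertex_gram_eq: "vertex_gram (face_gram prism a) i j = H i j"
proof -
  have "H i j * d i * d j / (d i * d j) = H i j"
    using d_pos[of i] d_pos[of j] by simp
  then show ?thesis
    by (simp add: vertex_gram_def cramer_inverse_eq sqrt_diag Let_def)
qed

text \<open>For \<open>H k m = - cosh\<close>, \<open>- sinh\<close> or \<open>- cos\<close> of the length this is \<open>sinh\<close>, \<open>cosh\<close> or \<open>sin\<close> of it: the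
  number \<open>\<sigma>\<^sub>k\<^sub>m\<close>, divided by \<open>\<i>\<close> for the edge \<open>E12\<close> in the prism truncated case.\<close>
definition sigma :: "edge \<Rightarrow> real" where
  "sigma e = (case ends e of (k, m) \<Rightarrow> sqrt (kappa prism e * ((H k m)\<^sup>2 - delta k * delta m)))"

lemma kappa_H_pos:
  assumes "ends e = (k, m)"
  shows "kappa prism e * ((H k m)\<^sup>2 - delta k * delta m) > 0"
proof -
  have one: "x\<^sup>2 > 1" if "x < -1" for x :: real
    using that power_strict_mono[of 1 "- x" 2] by simp
  have "(H 1 2)\<^sup>2 < 1" if prism using H12 that by (simp add: abs_square_less_1)
  moreover have "(H 1 2)\<^sup>2 > 1" if "\<not> prism" using H12 that one by simp
  moreover have "(H 3 4)\<^sup>2 > 1" using H34 one by simp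
  moreover have "x\<^sup>2 + 1 > 0" for x :: real by (simp add: add_nonneg_pos)
  ultimately show ?thesis
    using assms by (cases e) (auto simp: kappa_def delta_def)
qed

lemma sigma_pos: "sigma e > 0"
  using kappa_H_pos[of e] by (simp add: sigma_def split: prod.splits)

lemma sigma_squared:
  assumes "ends e = (k, m)"
  shows "(sigma e)\<^sup>2 = kappa prism e * ((H k m)\<^sup>2 - delta k * delta m)"
  using kappa_H_pos[OF assms] assms by (simp add: sigma_def)

lemma sigma_edge_joining_squared:
  assumes "k \<noteq> m"
  shows "(sigma (edge_joining k m))\<^sup>2 = kappa prism (edge_joining k m) * ((H k m)\<^sup>2 - delta k * delta m)"
proof -
  have "ends (edge_joining k m) = (k, m) \<or> ends (edge_joining k m) = (m, k)"
    using verts_edge_joining[OF assms] by (cases "ends (edge_joining k m)") (auto simp: verts_def doubleton_eq_iff)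
  then show ?thesis using sigma_squared[of "edge_joining k m"] H_commute by (metis mult.commute)
qed

definition sine :: "edge \<Rightarrow> real" where
  "sine f = (if prism \<and> f = E12 then sinh (a $ f) else sin (a $ f))"

lemma sine_pos: "sine f > 0"
  using a_pos[of f] a_less_pi[of f] by (auto simp: sine_def sin_gt_zero)

lemma has_derivative_face_gram:
  "((\<lambda>x. face_gram prism x $ p $ q) has_derivative
     (\<lambda>h. if p = q then 0 else let f = opposite (edge_joining p q) in kappa prism f * sine f * h $ f)) (at a)"
proof (cases "p = q")
  case False
  let ?f = "opposite (edge_joining p q)"
  have nth: "((\<lambda>x::real^edge. x $ ?f) has_derivative (\<lambda>h. h $ ?f)) (at a)"
    by (rule bounded_linear_imp_has_derivative) (rule bounded_linear_vec_nth)
  have cosh: "((\<lambda>x::real^edge. cosh (x $ ?f)) has_derivative (\<lambda>h. h $ ?f * sinh (a $ ?f))) (at a)"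
    by (rule DERIV_compose_FDERIV[OF _ nth]) (auto intro!: derivative_eq_intros)
  show ?thesis
    using False cosh
    by (auto simp: face_gram_def Let_def sine_def kappa_def mult.commute intro!: derivative_eq_intros nth)
qed (simp add: face_gram_def)

text \<open>The number \<open>\<eta>\<close>, which is real and positive in both cases; see \<open>eta_complexify\<close>.\<close>
definition eta_real :: real where
  "eta_real = sqrt (- det (face_gram prism a)) * (\<Prod>i\<in>UNIV. d i)"

text \<open>A law of sines. The minor \<open>1 - G\<^sub>p\<^sub>q\<^sup>2\<close> is \<open>sin\<^sup>2\<close> of the angle at the edge \<open>kl\<close> (or \<open>- sinh\<^sup>2\<close>), and the complementary minor of
  the inverse is \<open>- \<sigma>\<^sub>k\<^sub>l\<^sup>2\<close> up to scaling. The signs \<open>\<kappa>\<close> on the two sides agree, so that the identity has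
  the same form in both cases.\<close>
lemma sine_eq:
  assumes "distinct [p, q, k, l]"
  shows "sine (edge_joining k l) = sqrt (- det (face_gram prism a)) * (sigma (edge_joining k l) * d k * d l)"
proof -
  let ?f = "edge_joining k l" and ?G = "face_gram prism a"
  have f: "opposite (edge_joining p q) = ?f" "opposite (edge_joining q p) = ?f"
    using opposite_edge_joining[OF assms] by (simp_all add: edge_joining_commute)
  have neq: "p \<noteq> q" "k \<noteq> l" using assms by auto
  have "?G $ p $ p * ?G $ q $ q - ?G $ p $ q * ?G $ q $ p
      = det ?G * ((H k k * d k * d k) * (H l l * d l * d l) - (H k l * d k * d l) * (H l k * d l * d k))"
    using jacobi_complementary_minor[OF inverse assms] by simp
  also have "\<dots> = - det ?G * ((H k l)\<^sup>2 - delta k * delta l) * (d k)\<^sup>2 * (d l)\<^sup>2"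
    by (simp add: H_diag H_commute[of l k] power2_eq_square algebra_simps)
  also have "?G $ p $ p * ?G $ q $ q - ?G $ p $ q * ?G $ q $ p = kappa prism ?f * (sine ?f)\<^sup>2"
    using neq f by (simp add: face_gram_def Let_def sine_def kappa_def sin_squared_eq sinh_square_eq
        flip: power2_eq_square)
  finally have "kappa prism ?f * (kappa prism ?f * (sine ?f)\<^sup>2)
      = kappa prism ?f * (- det ?G * ((H k l)\<^sup>2 - delta k * delta l) * (d k)\<^sup>2 * (d l)\<^sup>2)" by simp
  then have "(sine ?f)\<^sup>2 = - det ?G * (sigma ?f)\<^sup>2 * (d k)\<^sup>2 * (d l)\<^sup>2"
    by (simp add: sigma_edge_joining_squared[OF neq(2)] mult_ac)
  also have "- det ?G = (sqrt (- det ?G))\<^sup>2"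
    using det_neg by simp
  finally have "(sine ?f)\<^sup>2 = (sqrt (- det ?G) * (sigma ?f * d k * d l))\<^sup>2"
    by (simp add: power_mult_distrib mult_ac)
  then show ?thesis
    using sine_pos[of ?f] sigma_pos[of ?f] d_pos[of k] d_pos[of l] det_neg
    by (simp add: power2_eq_iff_nonneg less_imp_le)
qed

text \<open>The differential of the entry \<open>(p, q)\<close> of the face Gram matrix, multiplied by \<open>d p * d q\<close>. By the law of sines it
  takes this form, in which the common factor \<open>\<eta>\<close> is visible.\<close>
definition scaled_dG :: "4 \<Rightarrow> 4 \<Rightarrow> real^edge \<Rightarrow> real" where
  "scaled_dG p q h = (if p = q then 0 else
     let f = opposite (edge_joining p q) in eta_real * kappa prism f * sigma f * h $ f)"

lemma scaled_dG_eq: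
  "d p * (if p = q then 0 else let f = opposite (edge_joining p q) in kappa prism f * sine f * h $ f) * d q
    = scaled_dG p q h"
proof (cases "p = q")
  case False
  then obtain k l where "{k, l} = - {p, q}" "k \<noteq> l"
  proof -
    have "card (- {p, q}) = 2"
      using False by (simp add: Compl_eq_Diff_UNIV card_Diff_subset)
    then show ?thesis using that by (metis card_2_iff)
  qed
  then have dist: "distinct [p, q, k, l]" using False by auto
  have f: "opposite (edge_joining p q) = edge_joining k l"
    using dist by (rule opposite_edge_joining)
  have "(\<Prod>i\<in>UNIV. d i) = d p * d q * d k * d l" using dist by (rule prod_4_distinct)
  then show ?thesis
    using False by (simp add: scaled_dG_def f sine_eq[OF dist] eta_real_def Let_def mult_ac)
qed (simp add: scaled_dG_def)

text \<open>Differentiate \<open>M\<^sub>i\<^sub>j / (d\<^sub>i d\<^sub>j)\<close> using \<open>dM = - M dG M\<close> and replace \<open>M\<close> by \<open>H\<close>; all factors \<open>d\<close> are absorbed by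
  \<open>scaled_dG\<close>. Because of \<open>H\<^sub>i\<^sub>i = \<delta>\<^sub>i\<close> and \<open>\<delta>\<^sub>i\<^sup>2 = 1\<close> all coefficients but that of \<open>scaled_dG k l h\<close> have the
  factor \<open>H\<^sub>i\<^sub>j\<^sup>2 - \<delta>\<^sub>i \<delta>\<^sub>j\<close>.\<close>
lemma has_derivative_vertex_gram:
  assumes dist: "distinct [i, j, k, l]"
  shows "((\<lambda>x. vertex_gram (face_gram prism x) i j) has_derivative
    (\<lambda>h. ((H i j)\<^sup>2 - delta i * delta j) *
          (scaled_dG i j h + delta j * H k j * scaled_dG i k h + delta i * H l i * scaled_dG j l h
           + delta j * H l j * scaled_dG i l h + delta i * H k i * scaled_dG j k h)
        - (H i k * H j l + H i l * H j k
           - H i j * (delta i * H i k * H i l + delta j * H j k * H j l)) * scaled_dG k l h)) (at a)"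
proof -
  let ?C = "\<lambda>x. cramer_inverse (face_gram prism x)"
  define G' where "G' p q h = (if p = q then 0 else let f = opposite (edge_joining p q) in kappa prism f * sine f * h $ f)"
    for p q and h :: "real^edge"
  define M' where "M' i j h = - (\<Sum>p\<in>UNIV. \<Sum>q\<in>UNIV. (H i p * d i * d p) * G' p q h * (H q j * d q * d j))"
    for i j h
  have dM: "((\<lambda>x. ?C x $ i $ j) has_derivative M' i j) (at a)" for i j
    using has_derivative_cramer_inverse[of "face_gram prism" _ a i j, OF has_derivative_face_gram] det_neg
    by (simp add: M'_def[abs_def] G'_def cramer_inverse_eq)
  have M'_eq: "M' i j h = d i * d j * - (\<Sum>p\<in>UNIV. \<Sum>q\<in>UNIV. H i p * scaled_dG p q h * H q j)" for i j h
    unfolding M'_def scaled_dG_eq[symmetric] G'_def[symmetric]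
    by (simp add: sum_distrib_left mult_ac)
  have pos: "delta i * ?C a $ i $ i > 0" for i
  proof -
    have "delta i * ?C a $ i $ i = d i * d i"
      by (simp add: cramer_inverse_eq H_diag mult.assoc)
    then show ?thesis using d_pos[of i] by simp
  qed
  have root: "sqrt (delta i * ?C a $ i $ i) = d i" for i
    using sqrt_diag by (simp add: cramer_inverse_eq)
  have "((\<lambda>x. vertex_gram (face_gram prism x) i j) has_derivative
    (\<lambda>h. M' i j h / (d i * d j) - H i j * (delta i * M' i i h / (2 * (d i)\<^sup>2) + delta j * M' j j h / (2 * (d j)\<^sup>2))))
    (at a)"
    unfolding vertex_gram_def Let_def
    using pos[of i] pos[of j] d_pos[of i] d_pos[of j]
    by (auto intro!: derivative_eq_intros dM simp: root fun_eq_iff)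
      (simp add: cramer_inverse_eq field_simps power2_eq_square)
  moreover have "M' i j h / (d i * d j) - H i j * (delta i * M' i i h / (2 * (d i)\<^sup>2) + delta j * M' j j h / (2 * (d j)\<^sup>2))
    = ((H i j)\<^sup>2 - delta i * delta j) *
          (scaled_dG i j h + delta j * H k j * scaled_dG i k h + delta i * H l i * scaled_dG j l h
           + delta j * H l j * scaled_dG i l h + delta i * H k i * scaled_dG j k h)
        - (H i k * H j l + H i l * H j k
           - H i j * (delta i * H i k * H i l + delta j * H j k * H j l)) * scaled_dG k l h" for h
  proof -
    have T: "scaled_dG p p h = 0" "scaled_dG p q h = scaled_dG q p h" for p q
      by (auto simp: scaled_dG_def edge_joining_commute)
    have "M' i j h / (d i * d j) - H i j * (delta i * M' i i h / (2 * (d i)\<^sup>2) + delta j * M' j j h / (2 * (d j)\<^sup>2))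
      = - (\<Sum>p\<in>UNIV. \<Sum>q\<in>UNIV. H i p * scaled_dG p q h * H q j)
        + H i j * (delta i * (\<Sum>p\<in>UNIV. \<Sum>q\<in>UNIV. H i p * scaled_dG p q h * H q i) / 2
          + delta j * (\<Sum>p\<in>UNIV. \<Sum>q\<in>UNIV. H j p * scaled_dG p q h * H q j) / 2)"
      unfolding M'_eq using d_pos[of i] d_pos[of j] by (simp add: field_simps power2_eq_square)
    also have "\<dots> = ((H i j)\<^sup>2 - delta i * delta j) *
          (scaled_dG i j h + delta j * H k j * scaled_dG i k h + delta i * H l i * scaled_dG j l h
           + delta j * H l j * scaled_dG i l h + delta i * H k i * scaled_dG j k h)
        - (H i k * H j l + H i l * H j k
           - H i j * (delta i * H i k * H i l + delta j * H j k * H j l)) * scaled_dG k l h"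
      unfolding sum_4_distinct[OF dist] T(1) T(2)[of j i] T(2)[of k i] T(2)[of l i] T(2)[of k j] T(2)[of l j] T(2)[of l k]
        H_diag H_commute[of j i] H_commute[of k i] H_commute[of l i] H_commute[of k j] H_commute[of l j] H_commute[of l k]
      using delta_cases[of i] delta_cases[of j]
      by (elim disjE) (simp_all add: field_simps power2_eq_square)
    finally show ?thesis .
  qed
  ultimately show ?thesis by simp
qed

lemma Smat_real_opposite: "Smat_real H e (opposite e) = 1"
  by (cases e) (simp_all add: Smat_real_def)

lemma Smat_real_adjacent:
  assumes dist: "distinct [i, j, k, l]"
  shows "Smat_real H (edge_joining i j) (edge_joining j l) = delta j * H k j"
proof -
  have "edge_joining j l \<noteq> edge_joining i j" "edge_joining j l \<noteq> opposite (edge_joining i j)"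
    using dist by (auto simp: opposite_edge_joining[OF dist] edge_joining_eq_iff doubleton_eq_iff)
  then show ?thesis
    unfolding Smat_real_def the_common_vertex[OF dist] Let_def by simp
qed

lemma Smat_real_diag:
  assumes "ends e = (i, j)" "ends (opposite e) = (k, l)"
  shows "((H i j)\<^sup>2 - delta i * delta j) * Smat_real H e e =
    - (H i k * H j l + H i l * H j k - H i j * (delta i * H i k * H i l + delta j * H j k * H j l))"
proof -
  have "(H i j)\<^sup>2 - delta i * delta j \<noteq> 0" using kappa_H_pos[OF assms(1)] by auto
  moreover have "Smat_real H e e =
      - (H i k * H j l + H i l * H j k - H i j * (delta i * H i k * H i l + delta j * H j k * H j l))
        / ((H i j)\<^sup>2 - delta i * delta j)"
    by (simp add: Smat_real_def assms H_commute[of k i] H_commute[of k j] H_commute[of l i] H_commute[of l j]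
        algebra_simps)
  ultimately show ?thesis by simp
qed

text \<open>The extra sign \<open>kappa prism f\<close> comes from \<open>d (- cosh \<ell>) = - sinh \<ell> d\<ell>\<close>, as opposed to \<open>d (- cos a) = sin a da\<close>.\<close>
definition jac :: "real^edge^edge" where
  "jac = (\<chi> e f. - (eta_real * sigma e * Smat_real H e f * sigma f * kappa prism f))"

text \<open>The increment \<open>scaled_dG p q h\<close> belongs to the edge opposite to \<open>pq\<close>. So the coefficient of \<open>scaled_dG i j h\<close> is the entry of
  \<open>\<S>\<close> at the opposite edge, that of \<open>scaled_dG k l h\<close> the diagonal entry, and the others belong to the adjacent
  edges.\<close>
lemma has_derivative_vertex_gram_edge:
  assumes e: "ends e = (i, j)"
  shows "((\<lambda>x. vertex_gram (face_gram prism x) i j) has_derivative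
    (\<lambda>h. kappa prism e * (sigma e)\<^sup>2 * (\<Sum>f\<in>UNIV. Smat_real H e f * eta_real * kappa prism f * sigma f * h $ f))) (at a)"
proof -
  obtain k l where o: "ends (opposite e) = (k, l)" by fastforce
  have dist: "distinct [i, j, k, l]" using ends_distinct[OF e o] .
  have eij: "e = edge_joining i j" using edge_joining_ends[OF e] by simp
  have ekl: "edge_joining k l = opposite e" using edge_joining_ends[OF o] .
  define c where "c f = eta_real * kappa prism f * sigma f" for f
  have T: "scaled_dG p q h = c f * h $ f" if "distinct [p, q, u, v]" "f = edge_joining u v" for p q u v f h
    using that opposite_edge_joining[OF that(1)] by (simp add: scaled_dG_def c_def Let_def)
  have S: "Smat_real H e (edge_joining j l) = delta j * H k j" "Smat_real H e (edge_joining j k) = delta j * H l j"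
     "Smat_real H e (edge_joining i k) = delta i * H l i" "Smat_real H e (edge_joining i l) = delta i * H k i"
    using Smat_real_adjacent[of i j k l] Smat_real_adjacent[of i j l k]
      Smat_real_adjacent[of j i k l] Smat_real_adjacent[of j i l k] dist
    by (auto simp: eij edge_joining_commute[of j i])
  have "((H i j)\<^sup>2 - delta i * delta j) *
          (scaled_dG i j h + delta j * H k j * scaled_dG i k h + delta i * H l i * scaled_dG j l h
           + delta j * H l j * scaled_dG i l h + delta i * H k i * scaled_dG j k h)
        - (H i k * H j l + H i l * H j k
           - H i j * (delta i * H i k * H i l + delta j * H j k * H j l)) * scaled_dG k l h
      = kappa prism e * (sigma e)\<^sup>2 * (\<Sum>f\<in>UNIV. Smat_real H e f * eta_real * kappa prism f * sigma f * h $ f)" for h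
  proof -
    have TT: "scaled_dG i j h = c (edge_joining k l) * h $ edge_joining k l"
      "scaled_dG k l h = c (edge_joining i j) * h $ edge_joining i j"
      "scaled_dG i k h = c (edge_joining j l) * h $ edge_joining j l"
      "scaled_dG j l h = c (edge_joining i k) * h $ edge_joining i k"
      "scaled_dG i l h = c (edge_joining j k) * h $ edge_joining j k"
      "scaled_dG j k h = c (edge_joining i l) * h $ edge_joining i l"
      using T[of i j k l] T[of k l i j] T[of i k j l] T[of j l i k] T[of i l j k] T[of j k i l] dist
      by auto
    have "(\<Sum>f\<in>UNIV. Smat_real H e f * eta_real * kappa prism f * sigma f * h $ f)
        = (\<Sum>f\<in>UNIV. Smat_real H e f * (c f * h $ f))"
      by (simp add: c_def mult_ac)
    also have "\<dots> = Smat_real H e e * scaled_dG k l h + scaled_dG i j h + delta i * H l i * scaled_dG j l h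
        + delta j * H k j * scaled_dG i k h + delta i * H k i * scaled_dG j k h + delta j * H l j * scaled_dG i l h"
      unfolding sum_edge_distinct[OF dist] TT S ekl Smat_real_opposite by (simp add: eij mult_ac)
    finally have "kappa prism e * (sigma e)\<^sup>2 * (\<Sum>f\<in>UNIV. Smat_real H e f * eta_real * kappa prism f * sigma f * h $ f)
        = ((H i j)\<^sup>2 - delta i * delta j) * Smat_real H e e * scaled_dG k l h
          + ((H i j)\<^sup>2 - delta i * delta j) * (scaled_dG i j h + delta i * H l i * scaled_dG j l h
        + delta j * H k j * scaled_dG i k h + delta i * H k i * scaled_dG j k h + delta j * H l j * scaled_dG i l h)"
      unfolding sigma_squared[OF e] by (simp add: algebra_simps)
    then show ?thesis unfolding Smat_real_diag[OF e o] by (simp add: algebra_simps)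
  qed
  then show ?thesis using has_derivative_vertex_gram[OF dist] by simp
qed

lemma has_derivative_length_of:
  assumes "ends e = (k, m)"
  shows "(length_of prism e has_real_derivative kappa prism e / sigma e) (at (- H k m))"
proof -
  have s: "sigma e = sqrt (kappa prism e * ((H k m)\<^sup>2 - delta k * delta m))"
    using assms by (simp add: sigma_def)
  consider "e = E12" prism | "e = E12" "\<not> prism" | "e = E34" | "e \<noteq> E12" "e \<noteq> E34" by blast
  then show ?thesis
  proof cases
    case 1
    then have "length_of prism e = arccos" by (simp add: length_of_def fun_eq_iff)
    moreover have "k = 1" "m = 2" using 1 assms by auto
    moreover have "kappa prism e = -1" "\<bar>H 1 2\<bar> < 1" using 1 H12 by (simp_all add: kappa_def)
    ultimately show ?thesis
      using DERIV_arccos[of "- H 1 2"] by (simp add: s delta_def divide_inverse)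
  next
    case 2
    then have "length_of prism e = arcosh" by (simp add: length_of_def fun_eq_iff)
    moreover have "k = 1" "m = 2" using 2 assms by auto
    moreover have "kappa prism e = 1" "H 1 2 < -1" using 2 H12 by (simp_all add: kappa_def)
    ultimately show ?thesis
      using arcosh_real_has_field_derivative[of "- H 1 2"] by (simp add: s delta_def)
  next
    case 3
    then have "length_of prism e = arcosh" by (simp add: length_of_def fun_eq_iff)
    moreover have "k = 3" "m = 4" using 3 assms by auto
    moreover have "kappa prism e = 1" using 3 by (simp add: kappa_def)
    ultimately show ?thesis
      using arcosh_real_has_field_derivative[of "- H 3 4"] H34 by (simp add: s delta_def)
  next
    case 4
    then have "length_of prism e = arsinh" by (simp add: length_of_def fun_eq_iff)
    moreover have "delta k * delta m = -1" using 4 assms by (cases e) (auto simp: delta_def)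
    ultimately show ?thesis
      using 4 arsinh_real_has_field_derivative[of "- H k m"] by (simp add: s kappa_def)
  qed
qed

lemma has_derivative_length_map: "(length_map prism has_derivative (\<lambda>h. jac *v h)) (at a)"
proof -
  have "((\<lambda>x. length_map prism x $ e) has_derivative (\<lambda>h. (jac *v h) $ e)) (at a)" for e
  proof -
    obtain k m where e: "ends e = (k, m)" by fastforce
    have "((\<lambda>x. length_of prism e (- vertex_gram (face_gram prism x) k m)) has_derivative
        (\<lambda>h. - (kappa prism e * (sigma e)\<^sup>2 * (\<Sum>f\<in>UNIV. Smat_real H e f * eta_real * kappa prism f * sigma f * h $ f))
           * (kappa prism e / sigma e))) (at a)"
      using has_derivative_length_of[OF e] has_derivative_minus[OF has_derivative_vertex_gram_edge[OF e]]
      by (intro DERIV_compose_FDERIV) (simp_all add: vertex_gram_eq)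
    moreover have "- (kappa prism e * (sigma e)\<^sup>2 * (\<Sum>f\<in>UNIV. Smat_real H e f * eta_real * kappa prism f * sigma f * h $ f))
           * (kappa prism e / sigma e) = (jac *v h) $ e" for h
    proof -
      have "- (kappa prism e * (sigma e)\<^sup>2 * X) * (kappa prism e / sigma e) = - (sigma e * X)" for X
        using sigma_pos[of e] by (simp add: power2_eq_square kappa_def)
      then show ?thesis
        by (simp only:) (simp add: jac_def matrix_vector_mult_def sum_distrib_left sum_negf mult_ac)
    qed
    ultimately show ?thesis
      using e by (simp add: length_map_def)
  qed
  then show ?thesis
    by (subst has_derivative_componentwise_within) (auto simp: Basis_vec_def inner_axis)
qed

end

section \<open>Vectors with a prescribed Gram matrix\<close>

text \<open>A Cholesky factorization for signature \<open>(3, 1)\<close>. The first three vectors are purely spatial and in triangular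
  form; positivity of the leading minors makes the square roots \<open>s\<close> and \<open>r\<close> real. The space part of the fourth
  vector is then forced, and the time coordinate \<open>t\<close> corrects its square to 1, which is possible since
  \<open>det G = - s\<^sup>2 r\<^sup>2 t\<^sup>2\<close> is negative.\<close>
lemma ex_vectors_with_gram:
  fixes G :: "real^4^4"
  assumes sym: "\<And>i j. G $ i $ j = G $ j $ i" and diag: "\<And>i. G $ i $ i = 1"
    and m2: "1 - (G $ 1 $ 2)\<^sup>2 > 0"
    and m3: "1 - (G $ 1 $ 2)\<^sup>2 - (G $ 1 $ 3)\<^sup>2 - (G $ 2 $ 3)\<^sup>2 + 2 * G $ 1 $ 2 * G $ 1 $ 3 * G $ 2 $ 3 > 0"
    and m4: "det G < 0"
  shows "\<exists>n. \<forall>i j. lor (n i) (n j) = G $ i $ j"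
proof -
  define s where "s = sqrt (1 - (G $ 1 $ 2)\<^sup>2)"
  define y3 where "y3 = (G $ 2 $ 3 - G $ 1 $ 2 * G $ 1 $ 3) / s"
  define y4 where "y4 = (G $ 2 $ 4 - G $ 1 $ 2 * G $ 1 $ 4) / s"
  define r2 where "r2 = 1 - (G $ 1 $ 3)\<^sup>2 - y3\<^sup>2"
  have s: "s > 0" "s\<^sup>2 = 1 - (G $ 1 $ 2)\<^sup>2" using m2 by (simp_all add: s_def)
  have G23: "G $ 2 $ 3 = G $ 1 $ 2 * G $ 1 $ 3 + s * y3"
    and G24: "G $ 2 $ 4 = G $ 1 $ 2 * G $ 1 $ 4 + s * y4"
    using s by (simp_all add: y3_def y4_def)
  have "s\<^sup>2 * r2 = s\<^sup>2 * (1 - (G $ 1 $ 3)\<^sup>2) - (s * y3)\<^sup>2"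
    by (simp add: r2_def power_mult_distrib algebra_simps)
  also have "\<dots> = 1 - (G $ 1 $ 2)\<^sup>2 - (G $ 1 $ 3)\<^sup>2 - (G $ 2 $ 3)\<^sup>2 + 2 * G $ 1 $ 2 * G $ 1 $ 3 * G $ 2 $ 3"
    unfolding s(2) using G23 by (simp add: power2_eq_square algebra_simps)
  finally have "s\<^sup>2 * r2 > 0" using m3 by simp
  then have "r2 > 0" using s(1) by (simp add: zero_less_mult_iff)
  define r where "r = sqrt r2"
  have r: "r > 0" "r\<^sup>2 = 1 - (G $ 1 $ 3)\<^sup>2 - y3\<^sup>2"
    using \<open>r2 > 0\<close> by (simp_all add: r_def) (simp add: r2_def)
  define z4 where "z4 = (G $ 3 $ 4 - G $ 1 $ 3 * G $ 1 $ 4 - y3 * y4) / r"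
  have G34: "G $ 3 $ 4 = G $ 1 $ 3 * G $ 1 $ 4 + y3 * y4 + r * z4"
    using r by (simp add: z4_def)
  have "det G = s\<^sup>2 * r\<^sup>2 * (1 - (G $ 1 $ 4)\<^sup>2 - y4\<^sup>2 - z4\<^sup>2)"
  proof -
  \<comment> \<open>With the diagonal entries 1 written as sums of squares the claim is a polynomial identity.\<close>
    define g12 g13 g14 where "g12 = G $ 1 $ 2" and "g13 = G $ 1 $ 3" and "g14 = G $ 1 $ 4"
    have e: "G $ 1 $ 2 = g12" "G $ 2 $ 1 = g12" "G $ 1 $ 3 = g13" "G $ 3 $ 1 = g13"
      "G $ 1 $ 4 = g14" "G $ 4 $ 1 = g14" "G $ 1 $ 1 = 1" "G $ 4 $ 4 = 1"
      "G $ 2 $ 2 = g12 * g12 + s * s" "G $ 3 $ 3 = g13 * g13 + y3 * y3 + r * r"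
      "G $ 2 $ 3 = g12 * g13 + s * y3" "G $ 3 $ 2 = g12 * g13 + s * y3"
      "G $ 2 $ 4 = g12 * g14 + s * y4" "G $ 4 $ 2 = g12 * g14 + s * y4"
      "G $ 3 $ 4 = g13 * g14 + y3 * y4 + r * z4" "G $ 4 $ 3 = g13 * g14 + y3 * y4 + r * z4"
      using diag s(2) r(2) G23 G24 G34 sym[of 2 1] sym[of 3 1] sym[of 4 1] sym[of 3 2] sym[of 4 2] sym[of 4 3]
      by (simp_all add: g12_def g13_def g14_def power2_eq_square)
    show ?thesis
      unfolding det_4 e by (simp add: power2_eq_square algebra_simps)
  qed
  then have "s\<^sup>2 * r\<^sup>2 * (1 - (G $ 1 $ 4)\<^sup>2 - y4\<^sup>2 - z4\<^sup>2) < 0" using m4 by simp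
  moreover have "s\<^sup>2 * r\<^sup>2 > 0" using s(1) r(1) by simp
  ultimately have neg: "1 - (G $ 1 $ 4)\<^sup>2 - y4\<^sup>2 - z4\<^sup>2 < 0" by (simp add: mult_less_0_iff)
  define t where "t = sqrt ((G $ 1 $ 4)\<^sup>2 + y4\<^sup>2 + z4\<^sup>2 - 1)"
  have t: "t\<^sup>2 = (G $ 1 $ 4)\<^sup>2 + y4\<^sup>2 + z4\<^sup>2 - 1" using neg by (simp add: t_def)
  define n :: "4 \<Rightarrow> minkowski" where "n i =
    (if i = 1 then (0, vector [1, 0, 0]) else if i = 2 then (0, vector [G $ 1 $ 2, s, 0])
     else if i = 3 then (0, vector [G $ 1 $ 3, y3, r]) else (t, vector [G $ 1 $ 4, y4, z4]))" for i
  have inner: "vector [x, y, z] \<bullet> (vector [x', y', z'] :: real^3) = x * x' + y * y' + z * z'"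
    for x y z x' y' z' :: real
    by (simp add: inner_vec_def sum_3)
  have "\<forall>i j. lor (n i) (n j) = G $ i $ j"
    unfolding forall_4 n_def lor_def
    using s(2) r(2) t G23 G24 G34 diag sym[of 2 1] sym[of 3 1] sym[of 4 1] sym[of 3 2] sym[of 4 2] sym[of 4 3]
    by (simp add: inner power2_eq_square algebra_simps)
  then show ?thesis by blast
qed

lemma independent_if_dual:
  fixes v n :: "4 \<Rightarrow> minkowski"
  assumes dual: "\<And>i j. lor (n i) (v j) = (if i = j then c i else 0)" and c: "\<And>i. c i \<noteq> 0"
  shows "inj v" "independent (range v)"
proof -
  show "inj v"
  proof (rule injI)
    fix i j assume "v i = v j"
    then show "i = j" using dual[of i i] dual[of i j] c[of i] by (auto split: if_splits)
  qed
  show "independent (range v)"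
  proof (rule independent_if_scalars_zero)
    fix f x assume sum: "(\<Sum>x\<in>range v. f x *\<^sub>R x) = 0" and "x \<in> range v"
    then obtain k where k: "x = v k" by blast
    have "(\<Sum>j\<in>UNIV. f (v j) *\<^sub>R v j) = 0"
      using sum sum.reindex[OF \<open>inj v\<close>, of "\<lambda>y. f y *\<^sub>R y"] by simp
    then have "lor (n k) (\<Sum>j\<in>UNIV. f (v j) *\<^sub>R v j) = 0"
      by (simp only: bilinear_rzero[OF bilinear_lor])
    then have "f (v k) * c k = 0"
      by (simp add: lor_sum_right lor_simps dual if_distrib cong: if_cong)
    then show "f x = 0" using c k by simp
  qed simp
qed

section \<open>The two kinds of truncated tetrahedra\<close>

definition truncated :: "bool \<Rightarrow> (4 \<Rightarrow> minkowski) \<Rightarrow> bool" where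
  "truncated prism v \<longleftrightarrow> (if prism then prism_truncated v else mildly_truncated v)"

definition angles :: "bool \<Rightarrow> (4 \<Rightarrow> minkowski) \<Rightarrow> real^edge" where
  "angles prism v = (if prism then prism_args v else mild_angles v)"

definition lengths :: "bool \<Rightarrow> (4 \<Rightarrow> minkowski) \<Rightarrow> real^edge" where
  "lengths prism v = (if prism then prism_vals v else mild_lengths v)"

lemma truncated_iff:
  "truncated prism v \<longleftrightarrow>
     doubly_truncated v \<and> (if prism then \<bar>lor (v 1) (v 2)\<bar> < 1 else lor (v 1) (v 2) < -1)"
  by (simp add: truncated_def prism_truncated_iff mildly_truncated_iff)

lemma lengths_eq:
  assumes "truncated prism v" "ends e = (k, l)"
  shows "lengths prism v $ e = length_of prism e (- lor (v k) (v l))"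
proof -
  have dv: "doubly_truncated v" and mild: "\<not> prism \<Longrightarrow> lor (v 1) (v 2) < -1"
    using assms by (auto simp: truncated_iff)
  show ?thesis
    using assms(2) edge_length_mixed[OF dv] edge_length_34[OF dv] edge_length_12[OF dv] mild
    by (cases e) (auto simp: lengths_def prism_vals_def mild_lengths_def length_of_def
        new_edge_angle_def angle_of_normals_def)
qed

lemma outward_normals_doubly_truncated:
  assumes "doubly_truncated v"
  shows "outward_normals v (outward_normal v)"
proof -
  note D = doubly_truncatedD[OF assms]
  have "\<exists>k. k \<noteq> i \<and> lor (v k) (v k) < 0" for i
    using D(5,6) by (cases "i = 3") (auto intro: exI[of _ 3] exI[of _ 4])
  then show ?thesis using outward_normals_outward_normal[OF D(1,2)] by blast
qed

lemma lor_doubly_truncated_diag: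
  assumes "doubly_truncated v"
  shows "lor (v i) (v i) = delta i"
  using doubly_truncatedD(3-6)[OF assms] exhaust_4[of i] by (auto simp: delta_def)

context
  fixes prism v n
  assumes v: "truncated prism v" and n: "outward_normals v n"
begin

text \<open>These are the factors \<open>d\<^sub>i\<close>.\<close>
definition weight :: "4 \<Rightarrow> real" where "weight i = - 1 / lor (n i) (v i)"

lemma doubly_truncated_if_truncated: "doubly_truncated v" using v by (simp add: truncated_iff)

lemma weight_pos: "weight i > 0"
  using n by (simp add: weight_def outward_normals_def divide_neg_neg)

lemma normal_gram_inverse:
  "(\<chi> i j. lor (n i) (n j)) ** (\<chi> i j. lor (v i) (v j) * weight i * weight j) = mat 1"
  using gram_normals_inverse[OF doubly_truncatedD(1,2)[OF doubly_truncated_if_truncated] n] by (simp add: weight_def)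

lemma one_minus_normal_gram_squared:
  assumes d: "distinct [p, q, k, l]"
  shows "1 - (lor (n p) (n q))\<^sup>2 =
    - det (\<chi> i j. lor (n i) (n j)) * ((lor (v k) (v l))\<^sup>2 - delta k * delta l) * (weight k * weight l)\<^sup>2"
  using jacobi_complementary_minor[OF normal_gram_inverse d] n
  by (simp add: outward_normals_def lor_doubly_truncated_diag[OF doubly_truncated_if_truncated] lor_commute[of "n q" "n p"]
      lor_commute[of "v l" "v k"] power2_eq_square algebra_simps)

text \<open>By Jacobi's identity it suffices to know the sign of one pair of complementary minors. At the edge
  \<open>e\<^sub>3\<^sub>4\<close> both are known: the normals \<open>n 1\<close> and \<open>n 2\<close> are orthogonal to the timelike \<open>v 3\<close>, hence span a positive definite
  plane, while \<open>v 3\<close> and \<open>v 4\<close> are distinct points of hyperbolic space.\<close>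
lemma det_normal_gram_neg: "det (\<chi> i j. lor (n i) (n j)) < 0"
proof -
  have N: "lor (n i) (n i) = 1" "j \<noteq> i \<Longrightarrow> lor (n i) (v j) = 0" "lor (n i) (v i) < 0" for i j
    using n by (auto simp: outward_normals_def)
  \<comment> \<open>The cases \<open>s = 1\<close> and \<open>s = -1\<close> bound \<open>lor (n 1) (n 2)\<close> from both sides.\<close>
  have "lor (n 1 + s *\<^sub>R n 2) (n 1 + s *\<^sub>R n 2) > 0" for s
  proof (rule spacelike_if_orthogonal_to_timelike)
    show "lor (v 3) (v 3) < 0" using doubly_truncatedD(5)[OF doubly_truncated_if_truncated] by simp
    show "lor (n 1 + s *\<^sub>R n 2) (v 3) = 0" using N(2)[of 3] by (simp add: lor_simps)
    have "lor (n 1 + s *\<^sub>R n 2) (v 1) \<noteq> 0" using N(2)[of 1 2] N(3)[of 1] by (simp add: lor_simps)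
    then show "n 1 + s *\<^sub>R n 2 \<noteq> 0" by (metis bilinear_lzero[OF bilinear_lor])
  qed
  from this[of 1] this[of "-1"] have "\<bar>lor (n 1) (n 2)\<bar> < 1"
    by (simp add: lor_simps N(1) lor_commute[of "n 2" "n 1"])
  then have pos: "1 - (lor (n 1) (n 2))\<^sup>2 > 0" by (simp add: abs_square_less_1)
  have "(lor (v 3) (v 4))\<^sup>2 > 1"
    using doubly_truncatedD(12)[OF doubly_truncated_if_truncated] power_strict_mono[of 1 "- lor (v 3) (v 4)" 2] by simp
  then have X: "((lor (v 3) (v 4))\<^sup>2 - delta 3 * delta 4) * (weight 3 * weight 4)\<^sup>2 > 0" (is "?X > 0")
    using weight_pos[of 3] weight_pos[of 4] by (simp add: delta_def)
  have "0 < - det (\<chi> i j. lor (n i) (n j)) * ?X"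
    using pos one_minus_normal_gram_squared[of 1 2 3 4] by (simp add: mult.assoc)
  then have "0 < - det (\<chi> i j. lor (n i) (n j))" by (rule zero_less_mult_pos2[OF _ X])
  then show ?thesis by simp
qed

text \<open>The sign of the determinant and Jacobi's identity bound the product of any two normals whose common edge
  passes through hyperbolic space.\<close>
lemma angles_eq:
  assumes f: "ends (opposite f) = (p, q)" and "\<not> (prism \<and> f = E12)"
  shows "angles prism v $ f = arccos (- lor (n p) (n q))" "\<bar>lor (n p) (n q)\<bar> < 1"
proof -
  have "outward_normal v = n"
    using outward_normal_eq doubly_truncatedD(1,2)[OF doubly_truncated_if_truncated] n by blast
  then show "angles prism v $ f = arccos (- lor (n p) (n q))"
    using assms by (auto simp: angles_def prism_args_def mild_angles_def dihedral_angle_def angle_of_normals_def)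
  obtain k l where kl: "ends f = (k, l)" by fastforce
  then have dist: "distinct [p, q, k, l]" using ends_distinct[of "opposite f"] f by simp
  have one: "x\<^sup>2 > 1" if "x < -1" for x :: real
    using that power_strict_mono[of 1 "- x" 2] by simp
  have plus: "x\<^sup>2 + 1 > 0" for x :: real by (simp add: add_nonneg_pos)
  have "(lor (v k) (v l))\<^sup>2 - delta k * delta l > 0"
    using kl assms(2) v one doubly_truncatedD(12)[OF doubly_truncated_if_truncated] plus
    by (cases f) (auto simp: delta_def truncated_iff)
  then have "((lor (v k) (v l))\<^sup>2 - delta k * delta l) * (weight k * weight l)\<^sup>2 > 0"
    using weight_pos[of k] weight_pos[of l] by simp
  then have "1 - (lor (n p) (n q))\<^sup>2 > 0"
    unfolding one_minus_normal_gram_squared[OF dist] using det_normal_gram_neg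
    by (simp add: mult_neg_pos mult.assoc)
  then show "\<bar>lor (n p) (n q)\<bar> < 1" by (simp add: abs_square_less_1)
qed

text \<open>Here the minor of the vertex Gram matrix has the opposite sign, so the faces \<open>F\<^sub>3\<close> and \<open>F\<^sub>4\<close> are
  ultraparallel.\<close>
lemma angles_E12_prism:
  assumes prism
  shows "angles prism v $ E12 = arcosh (- lor (n 3) (n 4))" "- lor (n 3) (n 4) > 1"
proof -
  have pv: "prism_truncated v" using v assms by (simp add: truncated_def)
  show "angles prism v $ E12 = arcosh (- lor (n 3) (n 4))"
    using new_edge_length(2)[OF pv n] assms by (simp add: angles_def prism_args_def)
  have "(lor (v 1) (v 2))\<^sup>2 - 1 < 0"
    using v assms by (simp add: truncated_iff abs_square_less_1)
  then have "((lor (v 1) (v 2))\<^sup>2 - delta 1 * delta 2) * (weight 1 * weight 2)\<^sup>2 < 0"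
    using weight_pos[of 1] weight_pos[of 2] by (simp add: delta_def mult_neg_pos)
  from mult_neg_neg[OF det_normal_gram_neg this] have "1 - (lor (n 3) (n 4))\<^sup>2 < 0"
    using one_minus_normal_gram_squared[of 3 4 1 2] by (simp add: mult.assoc)
  then have "1\<^sup>2 < (- lor (n 3) (n 4))\<^sup>2" by simp
  then show "- lor (n 3) (n 4) > 1"
    using new_edge_length(1)[OF pv n] power_less_imp_less_base[of 1 2 "- lor (n 3) (n 4)"] by simp
qed

lemma face_gram_angles: "face_gram prism (angles prism v) = (\<chi> i j. lor (n i) (n j))"
proof -
  have "face_gram prism (angles prism v) $ p $ q = lor (n p) (n q)" for p q
  proof (cases "p = q")
    case True
    then show ?thesis using n by (simp add: face_gram_def outward_normals_def)
  next
    case False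
    define f where "f = opposite (edge_joining p q)"
    have "ends (edge_joining p q) = (p, q) \<or> ends (edge_joining p q) = (q, p)"
      using verts_edge_joining[OF False]
      by (cases "ends (edge_joining p q)") (auto simp: verts_def doubleton_eq_iff)
    then obtain p' q' where f: "ends (opposite f) = (p', q')" and pq: "lor (n p') (n q') = lor (n p) (n q)"
      by (auto simp: f_def lor_commute)
    show ?thesis
    proof (cases "prism \<and> f = E12")
      case True
      then have "lor (n p) (n q) = lor (n 3) (n 4)" using f pq by simp
      then show ?thesis
        using angles_E12_prism True False by (simp add: face_gram_def cosh_arcosh_real flip: f_def)
    next
      case nE: False
      then have "cos (angles prism v $ f) = - lor (n p) (n q)"
        using angles_eq[OF f nE] pq by (simp add: cos_arccos)
      then show ?thesis using False nE by (auto simp: face_gram_def Let_def simp flip: f_def)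
    qed
  qed
  then show ?thesis by (simp add: vec_eq_iff)
qed

lemma gram_point_angles:
  "gram_point prism (angles prism v) (\<lambda>i j. lor (v i) (v j)) weight"
proof
  fix i j k :: 4 and e
  note D = doubly_truncatedD[OF doubly_truncated_if_truncated]
  show "lor (v i) (v j) = lor (v j) (v i)" by (rule lor_commute)
  show "lor (v i) (v i) = delta i" using doubly_truncated_if_truncated by (rule lor_doubly_truncated_diag)
  show "weight i > 0" by (rule weight_pos)
  show "face_gram prism (angles prism v) ** (\<chi> i j. lor (v i) (v j) * weight i * weight j) = mat 1"
    unfolding face_gram_angles by (rule normal_gram_inverse)
  show "det (face_gram prism (angles prism v)) < 0"
    unfolding face_gram_angles by (rule det_normal_gram_neg)
  show "if prism then \<bar>lor (v 1) (v 2)\<bar> < 1 else lor (v 1) (v 2) < - 1"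
    using v by (simp add: truncated_iff)
  show "lor (v 3) (v 4) < -1" by (rule D(12))
  show "lor (v i) (v k) < 0" if "i \<in> {1, 2}" "k \<in> {3, 4}" using D(11) that .
  obtain p q where pq: "ends (opposite e) = (p, q)" by fastforce
  have bounds: "0 < angles prism v $ e \<and> angles prism v $ e < pi" if "\<not> (prism \<and> e = E12)"
    using angles_eq[OF pq that] arccos_lt_bounded[of "- lor (n p) (n q)"] by auto
  show "0 < angles prism v $ e"
    using bounds angles_E12_prism arcosh_real_gt_1_iff[of "- lor (n 3) (n 4)"] by fastforce
  show "angles prism v $ e < pi" if "\<not> (prism \<and> e = E12)"
    using bounds[OF that] by simp
qed

end

lemma lengths_eq_length_map:
  assumes v: "truncated prism v"
  shows "lengths prism v = length_map prism (angles prism v)"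
proof -
  have "doubly_truncated v" using v by (simp add: truncated_iff)
  note n = outward_normals_doubly_truncated[OF this]
  interpret gram_point prism "angles prism v" "\<lambda>i j. lor (v i) (v j)" "weight v (outward_normal v)"
    using v n by (rule gram_point_angles)
  have "lengths prism v $ e = length_map prism (angles prism v) $ e" for e
    by (cases "ends e") (simp add: lengths_eq[OF v] length_map_def vertex_gram_eq)
  then show ?thesis by (simp add: vec_eq_iff)
qed

section \<open>Realizing nearby angles\<close>

lemma lor_time_reversal: "lor (- fst x, snd x) (- fst y, snd y) = lor x y"
  by (simp add: lor_def)

lemma symmetric_inverse:
  fixes A M :: "real^'n^'n::finite"
  assumes "A ** M = mat 1" "\<And>i j. A $ i $ j = A $ j $ i"
  shows "M $ i $ j = M $ j $ i"
proof -
  have "transpose A = A" using assms(2) by (simp add: transpose_def vec_eq_iff)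
  then have "transpose M ** A = mat 1"
    by (metis assms(1) matrix_transpose_mul transpose_mat)
  then have "transpose M = M"
    by (metis assms(1) matrix_mul_assoc matrix_mul_lid matrix_mul_rid)
  then show ?thesis by (simp add: transpose_def vec_eq_iff)
qed

text \<open>The conditions, all open in \<open>x\<close>, under which the scaled dual basis of vectors with Gram matrix
  \<open>face_gram prism x\<close> is a truncated tetrahedron with angles \<open>x\<close>. They express, in this order: the signature, the
  types of the vertices, the position of the proper vertices inside the truncating half-spaces and in a common
  cone, the kind of truncation, and the ranges of \<open>arccos\<close> and \<open>arcosh\<close>.\<close>
definition realizable :: "bool \<Rightarrow> real^edge \<Rightarrow> bool" where
  "realizable prism x \<longleftrightarrow>
     (let G = face_gram prism x; M = cramer_inverse G in
       det G < 0 \<and> (\<forall>i. delta i * M $ i $ i > 0) \<and>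
       (\<forall>i\<in>{1, 2}. \<forall>k\<in>{3, 4}. M $ i $ k < 0) \<and> M $ 3 $ 4 < 0 \<and>
       (if prism then \<bar>vertex_gram G 1 2\<bar> < 1 else vertex_gram G 1 2 < -1)) \<and>
     (\<forall>e. x $ e > 0 \<and> (\<not> (prism \<and> e = E12) \<longrightarrow> x $ e < pi))"

lemma face_gram_commute: "face_gram prism x $ i $ j = face_gram prism x $ j $ i"
  by (simp add: face_gram_def edge_joining_commute)

text \<open>Vectors \<open>n\<close> with the prescribed Gram matrix exist by \<open>ex_vectors_with_gram\<close>, up to a time reversal that makes the
  vertex 3 future-pointing. The vertices are the negatively scaled dual basis, so that the \<open>n\<close> are its
  outward normals.\<close>
lemma ex_truncated_if_realizable:
  assumes "realizable prism x"
  shows "\<exists>w. truncated prism w \<and> angles prism w = x"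
proof -
  define G where "G = face_gram prism x"
  define M where "M = cramer_inverse G"
  have det: "det G < 0" and diag: "\<And>i. delta i * M $ i $ i > 0"
    and mixed: "\<And>i k. i \<in> {1, 2} \<Longrightarrow> k \<in> {3, 4} \<Longrightarrow> M $ i $ k < 0" and M34: "M $ 3 $ 4 < 0"
    and H12: "if prism then \<bar>vertex_gram G 1 2\<bar> < 1 else vertex_gram G 1 2 < -1"
    and x_pos: "\<And>e. x $ e > 0" and x_pi: "\<And>e. \<not> (prism \<and> e = E12) \<Longrightarrow> x $ e < pi"
    using assms unfolding realizable_def G_def M_def Let_def by blast+
  have sym: "G $ i $ j = G $ j $ i" for i j
    unfolding G_def by (rule face_gram_commute)
  have one: "G $ i $ i = 1" for i by (simp add: G_def face_gram_def)
  have GM: "G ** M = mat 1" unfolding M_def using det by (intro cramer_inverse) simp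
  have Msym: "M $ i $ j = M $ j $ i" for i j using GM sym by (rule symmetric_inverse)
  have MG: "M ** G = mat 1" using GM by (rule matrix_left_right_inverse[THEN iffD1])
  \<comment> \<open>The leading minor of size two is \<open>sin\<^sup>2\<close> of the angle at \<open>e\<^sub>3\<^sub>4\<close>; the one of size three is \<open>M\<^sub>4\<^sub>4 det G\<close>.\<close>
  have "0 < sin (x $ E34)" using x_pos x_pi by (intro sin_gt_zero) auto
  then have m2: "1 - (G $ 1 $ 2)\<^sup>2 > 0"
    by (simp add: G_def face_gram_def sin_squared_eq[symmetric])
  have "M $ 4 $ 4 * det G = det (\<chi> i j. if j = 4 then axis 4 1 $ i else G $ i $ j)"
    using det by (simp add: M_def cramer_inverse_def)
  also have "\<dots> = 1 - (G $ 1 $ 2)\<^sup>2 - (G $ 1 $ 3)\<^sup>2 - (G $ 2 $ 3)\<^sup>2 + 2 * G $ 1 $ 2 * G $ 1 $ 3 * G $ 2 $ 3"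
    by (simp add: det_4 axis_def one sym[of 2 1] sym[of 3 1] sym[of 3 2] power2_eq_square algebra_simps)
  finally have m3: "1 - (G $ 1 $ 2)\<^sup>2 - (G $ 1 $ 3)\<^sup>2 - (G $ 2 $ 3)\<^sup>2 + 2 * G $ 1 $ 2 * G $ 1 $ 3 * G $ 2 $ 3 > 0"
    using diag[of 4] det mult_neg_neg[of "M $ 4 $ 4" "det G"] by (simp add: delta_def)
  obtain m where m: "\<And>i j. lor (m i) (m j) = G $ i $ j"
    using ex_vectors_with_gram[OF sym one m2 m3 det] by blast
  define r where "r i = 1 / sqrt (delta i * M $ i $ i)" for i
  have r: "r i > 0" for i using diag by (simp add: r_def)
  have r2: "r i * r i * M $ i $ i = delta i" for i
  proof -
    have "r i * r i * (delta i * M $ i $ i) = 1"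
      using diag[of i] by (auto simp: r_def)
    then show ?thesis using delta_cases[of i] by auto
  qed
  \<comment> \<open>The construction is stated for any \<open>n\<close>, since it is applied to \<open>m\<close> and to its time reversal.\<close>
  define vs where "vs n i = (- r i) *\<^sub>R (\<Sum>j\<in>UNIV. M $ i $ j *\<^sub>R n j)" for n :: "4 \<Rightarrow> minkowski" and i
  have *: "lor (n i) (vs n j) = (if i = j then - r i else 0)"
      "lor (vs n i) (vs n j) = r i * r j * M $ i $ j"
    if n: "\<And>i j. lor (n i) (n j) = G $ i $ j" for n i j
  proof -
    have dual: "lor (n i) (vs n j) = (if i = j then - r i else 0)" for i j
    proof -
      have "lor (n i) (vs n j) = - r j * (M ** G) $ j $ i"
        by (simp add: vs_def lor_simps lor_sum_right n matrix_matrix_mult_def sym[of i])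
      then show ?thesis by (simp add: MG mat_def)
    qed
    then show "lor (n i) (vs n j) = (if i = j then - r i else 0)" .
    have "lor (vs n i) (vs n j) = - r i * (\<Sum>k\<in>UNIV. M $ i $ k * lor (n k) (vs n j))"
      by (subst vs_def) (simp add: lor_simps lor_sum_left)
    also have "\<dots> = r i * r j * M $ i $ j"
      by (simp add: dual if_distrib cong: if_cong)
    finally show "lor (vs n i) (vs n j) = r i * r j * M $ i $ j" .
  qed
  obtain n where n: "\<And>i j. lor (n i) (n j) = G $ i $ j" and future: "fst (vs n 3) > 0"
  proof (cases "fst (vs m 3) > 0")
    case True
    then show ?thesis using that m by blast
  next
    case False
    define m' where "m' i = (- fst (m i), snd (m i))" for i
    have m': "lor (m' i) (m' j) = G $ i $ j" for i j by (simp add: m'_def lor_time_reversal m)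
    have "fst (vs m 3) \<noteq> 0"
    proof
      assume "fst (vs m 3) = 0"
      then have "lor (vs m 3) (vs m 3) \<ge> 0" by (simp add: lor_def)
      then show False using *(2)[OF m, of 3 3] r2[of 3] by (simp add: delta_def)
    qed
    moreover have "fst (vs m' 3) = - fst (vs m 3)"
      by (simp add: vs_def m'_def fst_sum sum_negf)
    ultimately show ?thesis using that m' False by force
  qed
  define w where "w = vs n"
  have dual: "lor (n i) (w j) = (if i = j then - r i else 0)" and H: "lor (w i) (w j) = r i * r j * M $ i $ j" for i j
    using *[OF n] by (simp_all add: w_def)
  have ind: "inj w" "independent (range w)"
    using independent_if_dual[OF dual] r[THEN less_imp_neq] by force+
  have Hdiag: "lor (w i) (w i) = delta i" for i using H r2 by simp
  have vg: "vertex_gram G i j = lor (w i) (w j)" for i j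
    by (simp add: vertex_gram_def H r_def Let_def flip: M_def)
  have neg: "lor (w i) (w j) < 0" if "M $ i $ j < 0" for i j
    using that r by (simp add: H mult_pos_neg)
  have w3: "w 3 \<in> H3" using Hdiag[of 3] future by (simp add: H3_def w_def delta_def)
  have "fst (w 4) > 0"
    using future_if_visible_from_future[of "w 4" "w 3"] Hdiag[of 4] neg[of 4 3] M34 Msym[of 4 3] w3
    by (simp add: delta_def)
  then have w4: "w 4 \<in> H3" using Hdiag[of 4] by (simp add: H3_def delta_def)
  have "doubly_truncated w"
    using ind w3 w4 Hdiag[of 1] Hdiag[of 2] neg mixed by (simp add: doubly_truncated_def delta_def)
  then have w: "truncated prism w" using H12[unfolded vg] by (simp add: truncated_iff)
  have nw: "outward_normals w n"
    using dual r n one by (simp add: outward_normals_def)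
  have "angles prism w $ f = x $ f" for f
  proof (cases "prism \<and> f = E12")
    case True
    then have "angles prism w $ f = arcosh (- G $ 3 $ 4)"
      using angles_E12_prism(1)[OF w nw] by (simp add: n)
    also have "- G $ 3 $ 4 = cosh (x $ f)" using True by (simp add: G_def face_gram_def)
    finally show ?thesis using x_pos[of f] by (simp add: arcosh_cosh_real)
  next
    case False
    obtain p q where pq: "ends (opposite f) = (p, q)" by fastforce
    then have "p \<noteq> q" "edge_joining p q = opposite f"
      using ends_distinct[OF pq] edge_joining_ends[OF pq] by (cases f; auto)+
    then have "- G $ p $ q = cos (x $ f)" using False by (auto simp: G_def face_gram_def Let_def)
    moreover have "angles prism w $ f = arccos (- G $ p $ q)"
      using angles_eq(1)[OF w nw pq False] by (simp add: n)
    ultimately show ?thesis using x_pos[of f] x_pi[OF False] by (simp add: arccos_cos)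
  qed
  then show ?thesis using w by (auto simp: vec_eq_iff)
qed

context gram_point
begin

text \<open>All quantities in \<open>realizable\<close> depend continuously on \<open>x\<close>, and \<open>H\<close> satisfies the inequalities strictly at \<open>a\<close>.\<close>
lemma eventually_realizable: "\<forall>\<^sub>F x in nhds a. realizable prism x"
proof -
  have tendsto: "(f \<longlongrightarrow> f a) (nhds a)" if "f differentiable (at a)" for f :: "real^edge \<Rightarrow> real"
    using differentiable_imp_continuous_within[OF that] by (simp add: isCont_def tendsto_at_iff_tendsto_nhds)
  have dG: "(\<lambda>x. face_gram prism x $ i $ j) differentiable (at a)" for i j
    using has_derivative_face_gram unfolding differentiable_def by blast
  have nz: "det (face_gram prism a) \<noteq> 0" using det_neg by simp
  let ?M = "\<lambda>x. cramer_inverse (face_gram prism x)"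
  have tM: "((\<lambda>x. ?M x $ i $ j) \<longlongrightarrow> ?M a $ i $ j) (nhds a)" for i j
    by (rule tendsto) (rule differentiable_cramer_inverse[OF dG nz])
  have M: "?M a $ i $ j = H i j * d i * d j" for i j by (simp add: cramer_inverse_eq)
  have diag: "delta i * ?M a $ i $ i > 0" for i
  proof -
    have "delta i * ?M a $ i $ i = d i * d i" by (simp add: M H_diag mult.assoc)
    then show ?thesis using d_pos[of i] by simp
  qed
  have neg: "\<forall>\<^sub>F x in nhds a. ?M x $ i $ j < 0" if "H i j < 0" for i j
    using that d_pos[of i] d_pos[of j] by (intro order_tendstoD(2)[OF tM]) (simp add: M mult_neg_pos)
  have "\<forall>\<^sub>F x in nhds a. det (face_gram prism x) < 0"
    by (rule order_tendstoD(2)[OF tendsto[OF differentiable_det[OF dG]] det_neg])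
  moreover have "\<forall>\<^sub>F x in nhds a. \<forall>i. delta i * ?M x $ i $ i > 0"
    using diag by (intro eventually_all_finite order_tendstoD(1)[OF tendsto_mult[OF tendsto_const tM]])
  moreover have "\<forall>\<^sub>F x in nhds a. \<forall>i\<in>{1, 2}. \<forall>k\<in>{3, 4}. ?M x $ i $ k < 0"
    using H_mixed by (intro eventually_ball_finite ballI neg) auto
  moreover have "\<forall>\<^sub>F x in nhds a. ?M x $ 3 $ 4 < 0"
    using H34 by (intro neg) simp
  moreover have "\<forall>\<^sub>F x in nhds a. if prism then \<bar>vertex_gram (face_gram prism x) 1 2\<bar> < 1
    else vertex_gram (face_gram prism x) 1 2 < -1"
  proof -
    have t: "((\<lambda>x. vertex_gram (face_gram prism x) 1 2) \<longlongrightarrow> H 1 2) (nhds a)"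
      using tendsto[of "\<lambda>x. vertex_gram (face_gram prism x) 1 2"] has_derivative_vertex_gram[of 1 2 3 4]
      by (auto simp: differentiable_def vertex_gram_eq)
    show ?thesis
      using H12 order_tendstoD(2)[OF tendsto_rabs[OF t], of 1] order_tendstoD(2)[OF t, of "-1"]
      by (cases prism) simp_all
  qed
  moreover have "\<forall>\<^sub>F x in nhds a. \<forall>e. x $ e > 0 \<and> (\<not> (prism \<and> e = E12) \<longrightarrow> x $ e < pi)"
  proof (rule eventually_all_finite)
    fix e
    have t: "((\<lambda>x::real^edge. x $ e) \<longlongrightarrow> a $ e) (nhds a)"
      by (rule tendsto_vec_nth) (rule filterlim_ident)
    have "\<forall>\<^sub>F x in nhds a. x $ e > 0" using order_tendstoD(1)[OF t] a_pos by blast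
    moreover have "\<forall>\<^sub>F x in nhds a. \<not> (prism \<and> e = E12) \<longrightarrow> x $ e < pi"
      using order_tendstoD(2)[OF t] a_less_pi by (cases "prism \<and> e = E12") auto
    ultimately show "\<forall>\<^sub>F x in nhds a. x $ e > 0 \<and> (\<not> (prism \<and> e = E12) \<longrightarrow> x $ e < pi)"
      by (rule eventually_conj)
  qed
  ultimately show ?thesis
    unfolding realizable_def Let_def by (intro eventually_conj)
qed

end

lemma has_jacobian_truncated:
  assumes v: "truncated prism v"
  shows "has_jacobian {(angles prism w, lengths prism w) | w. truncated prism w} (angles prism v)
    (gram_point.jac prism (angles prism v) (\<lambda>i j. lor (v i) (v j)) (weight v (outward_normal v)))"
proof -
  have dv: "doubly_truncated v" using v by (simp add: truncated_iff)
  interpret gram_point prism "angles prism v" "\<lambda>i j. lor (v i) (v j)" "weight v (outward_normal v)"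
    using v outward_normals_doubly_truncated[OF dv] by (rule gram_point_angles)
  have "\<forall>\<^sub>F x in nhds (angles prism v). \<forall>y.
      (x, y) \<in> {(angles prism w, lengths prism w) | w. truncated prism w} \<longleftrightarrow> y = length_map prism x"
    using eventually_realizable
  proof eventually_elim
    case (elim x)
    then obtain w where "truncated prism w" "angles prism w = x"
      using ex_truncated_if_realizable by blast
    then have w: "truncated prism w" "x = angles prism w" "length_map prism x = lengths prism w"
      using lengths_eq_length_map by auto
    show ?case
    proof (intro allI iffI)
      fix y assume "(x, y) \<in> {(angles prism w, lengths prism w) | w. truncated prism w}"
      then show "y = length_map prism x" using lengths_eq_length_map by auto
    next
      fix y assume "y = length_map prism x"
      then show "(x, y) \<in> {(angles prism w, lengths prism w) | w. truncated prism w}"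
        using w by auto
    qed
  qed
  then show ?thesis
    unfolding has_jacobian_def using has_derivative_length_map by blast
qed

section \<open>The matrix formula and analytic continuation\<close>

text \<open>The factor of the substitution, trivial for mildly truncated tetrahedra.\<close>
definition unit_of :: "bool \<Rightarrow> edge \<Rightarrow> complex" where
  "unit_of prism e = (if prism then unit_factor e else 1)"

definition complexify :: "bool \<Rightarrow> real^edge \<Rightarrow> complex^edge" where
  "complexify prism x = (\<chi> e. unit_of prism e * of_real (x $ e))"

lemma unit_of_squared: "unit_of prism e * unit_of prism e = of_real (kappa prism e)"
  by (simp add: unit_of_def unit_factor_def kappa_def)

lemma det_of_real:
  fixes A :: "real^'n^'n::finite"
  shows "det (\<chi> i j. complex_of_real (A $ i $ j)) = of_real (det A)"
  by (simp add: det_def)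

lemma cosh_complex_of_real: "cosh (complex_of_real y) = of_real (cosh y)"
  and sinh_complex_of_real: "sinh (complex_of_real y) = of_real (sinh y)"
  by (simp_all add: cosh_field_def sinh_field_def exp_of_real flip: of_real_minus)

lemma gram_complexify:
  "gram (complexify prism x) = (\<chi> i j. of_real (face_gram prism x $ i $ j))"
proof -
  have "cos (\<i> * of_real y) = (of_real (cosh y) :: complex)" for y :: real
    by (simp add: cosh_complex_of_real flip: cosh_conv_cos)
  then show ?thesis
    by (simp add: gram_def face_gram_def complexify_def unit_of_def unit_factor_def vec_eq_iff Let_def cos_of_real)
qed

lemma principal_minor_of_real:
  fixes G :: "real^4^4"
  assumes "det G \<noteq> 0"
  shows "principal_minor (\<chi> i j. of_real (G $ i $ j)) i = of_real (cramer_inverse G $ i $ i * det G)"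
proof -
  have "principal_minor (\<chi> i j. of_real (G $ i $ j)) i
      = det (\<chi> a b. complex_of_real ((\<chi> a b. if b = i then axis i 1 $ a else G $ a $ b) $ a $ b))"
    unfolding principal_minor_eq_det by (rule arg_cong[of _ _ det]) (simp add: vec_eq_iff axis_def)
  also have "\<dots> = of_real (det (\<chi> a b. if b = i then axis i 1 $ a else G $ a $ b))"
    by (rule det_of_real)
  finally show ?thesis using assms by (simp add: cramer_inverse_def)
qed

lemma Jac_formula_entry:
  "Jac_formula \<epsilon> a l $ e $ f = - (eta \<epsilon> a * Dmat \<epsilon> l $ e $ e * Smat \<epsilon> l $ e $ f * Dmat \<epsilon> l $ f $ f)"
proof -
  have right: "(X ** Dmat \<epsilon> l) $ e $ f = X $ e $ f * Dmat \<epsilon> l $ f $ f" for X e f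
    by (simp add: matrix_matrix_mult_def Dmat_def if_distrib cong: if_cong)
  have scalar: "(mat c ** X) $ e $ f = c * X $ e $ f" for c and X :: "complex^edge^edge" and e f
    by (simp add: matrix_matrix_mult_def mat_def if_distrib if_distribR cong: if_cong)
  have left: "(Dmat \<epsilon> l ** X) $ e $ f = Dmat \<epsilon> l $ e $ e * X $ e $ f" for X e f
    by (simp add: matrix_matrix_mult_def Dmat_def if_distrib if_distribR cong: if_cong)
  show ?thesis
    unfolding Jac_formula_def right
    by (simp add: scalar left mult.assoc flip: matrix_mul_assoc)
qed

context gram_point
begin

text \<open>Since \<open>\<epsilon>\<^sub>i det G\<^sub>i\<^sub>i = - \<delta>\<^sub>i M\<^sub>i\<^sub>i det G = d\<^sub>i\<^sup>2 (- det G)\<close>, the radicand is a positive real number in both cases and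
  the principal branch of the square root is the right one.\<close>
lemma eta_complexify: "eta (\<lambda>i. - delta i) (complexify prism a) = of_real eta_real"
proof -
  let ?D = "det (face_gram prism a)"
  have nz: "?D \<noteq> 0" using det_neg by simp
  have minor: "of_real (- delta i) * principal_minor (gram (complexify prism a)) i
      = complex_of_real ((d i)\<^sup>2 * (- ?D))" for i
  proof -
    have "- delta i * (cramer_inverse (face_gram prism a) $ i $ i * ?D) = (d i)\<^sup>2 * (- ?D)"
      by (simp add: cramer_inverse_eq H_diag power2_eq_square mult_ac)
    then show ?thesis
      by (simp only: gram_complexify principal_minor_of_real[OF nz] flip: of_real_mult)
  qed
  have "(\<Prod>i\<in>UNIV. of_real (- delta i) * principal_minor (gram (complexify prism a)) i)
      / (- det (gram (complexify prism a))) ^ 3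
      = complex_of_real ((\<Prod>i\<in>UNIV. (d i)\<^sup>2 * (- ?D)) / (- ?D) ^ 3)"
    unfolding minor by (simp add: gram_complexify det_of_real)
  also have "(\<Prod>i\<in>UNIV. (d i)\<^sup>2 * (- ?D)) = (\<Prod>i\<in>UNIV. d i)\<^sup>2 * (- ?D) * (- ?D) ^ 3"
    by (simp only: prod.distrib prod_power_distrib[symmetric] prod_constant)
      (simp add: power_numeral_reduce mult_ac)
  also have "\<dots> / (- ?D) ^ 3 = eta_real\<^sup>2"
    using det_neg by (simp add: eta_real_def power_mult_distrib)
  finally have "eta (\<lambda>i. - delta i) (complexify prism a) = csqrt (of_real (eta_real\<^sup>2))"
    by (simp only: eta_def)
  moreover have "eta_real \<ge> 0"
    using det_neg d_pos by (simp add: eta_real_def prod_nonneg less_imp_le)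
  ultimately show ?thesis by (simp del: of_real_power)
qed

abbreviation "L \<equiv> length_map prism a"

lemma L_eq: "ends e = (k, m) \<Longrightarrow> L $ e = length_of prism e (- H k m)"
  by (simp add: length_map_def vertex_gram_eq)

text \<open>The factor \<open>\<epsilon>\<^sub>k \<epsilon>\<^sub>m\<close> decides between \<open>sinh\<close> and \<open>cosh\<close>. At the imaginary length \<open>\<i> \<mu>\<close> these become \<open>\<i> sin \<mu>\<close> and \<open>cos \<mu>\<close>.\<close>
lemma sig_ends:
  assumes e: "ends e = (k, m)"
  shows "sig (\<lambda>i. - delta i) (complexify prism L) k m = unit_of prism e * of_real (sigma e)"
    and "sig' (\<lambda>i. - delta i) (complexify prism L) k m = of_real (- H k m)"
proof -
  define h where "h = - H k m"
  have s: "sigma e = sqrt (kappa prism e * (h\<^sup>2 - delta k * delta m))" using e by (simp add: sigma_def h_def)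
  have L: "L $ e = length_of prism e h" using L_eq[OF e] by (simp add: h_def)
  have ej: "edge_joining k m = e" using e by (rule edge_joining_ends)
  have cs: "exp (complex_of_real y) / 2 + exp (- complex_of_real y) / 2 = of_real (cosh y)"
     "exp (complex_of_real y) / 2 - exp (- complex_of_real y) / 2 = of_real (sinh y)" for y
    by (simp_all add: cosh_field_def sinh_field_def exp_of_real add_divide_distrib diff_divide_distrib
        flip: of_real_minus)
  have cis: "exp (\<i> * complex_of_real y) / 2 + exp (- (\<i> * complex_of_real y)) / 2 = of_real (cos y)"
     "exp (\<i> * complex_of_real y) / 2 - exp (- (\<i> * complex_of_real y)) / 2 = \<i> * of_real (sin y)" for y
    by (simp_all add: cos_of_real[symmetric] sin_of_real[symmetric] cos_exp_eq sin_exp_eq field_simps)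
  consider "e = E12" prism | "e = E12 \<and> \<not> prism \<or> e = E34" | "e \<noteq> E12" "e \<noteq> E34" by blast
  then have "sig (\<lambda>i. - delta i) (complexify prism L) k m = unit_of prism e * of_real (sigma e) \<and>
    sig' (\<lambda>i. - delta i) (complexify prism L) k m = of_real h"
  proof cases
    case 1
    then have "k = 1" "m = 2" using e by auto
    then have km: "delta k * delta m = 1" and "\<bar>h\<bar> < 1"
      using 1 H12 by (simp_all add: h_def delta_def)
    have u: "unit_of prism e = \<i>" "kappa prism e = -1" using 1 by (simp_all add: unit_of_def unit_factor_def kappa_def)
    have "L $ e = arccos h" using 1 L by (simp add: length_of_def)
    then have "cos (L $ e) = h" "sin (L $ e) = sigma e"
      using \<open>\<bar>h\<bar> < 1\<close> by (simp_all add: s u km sin_arccos)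
    then show ?thesis
      using cis[of "L $ e"] by (simp add: sig_def sig'_def ej complexify_def u km)
  next
    case 2
    then have km: "delta k * delta m = 1" using e by (auto simp: delta_def)
    have u: "unit_of prism e = 1" "kappa prism e = 1" using 2 by (auto simp: unit_of_def unit_factor_def kappa_def)
    have "L $ e = arcosh h" using 2 L by (auto simp: length_of_def)
    moreover have "h > 1" using 2 H12 H34 e by (auto simp: h_def)
    ultimately have "cosh (L $ e) = h" "sinh (L $ e) = sigma e"
      by (simp_all add: s u km cosh_arcosh_real sinh_arcosh_real)
    then show ?thesis
      using cs[of "L $ e"] by (simp add: sig_def sig'_def ej complexify_def u km)
  next
    case 3
    then have km: "delta k * delta m = -1" using e by (cases e) (auto simp: delta_def)
    have u: "unit_of prism e = 1" "kappa prism e = 1" using 3 by (auto simp: unit_of_def unit_factor_def kappa_def)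
    have "L $ e = arsinh h" using 3 L by (auto simp: length_of_def)
    then have "sinh (L $ e) = h" "cosh (L $ e) = sigma e"
      by (simp_all add: s u km cosh_arsinh_real)
    then show ?thesis
      using cs[of "L $ e"] by (simp add: sig_def sig'_def ej complexify_def u km)
  qed
  then show "sig (\<lambda>i. - delta i) (complexify prism L) k m = unit_of prism e * of_real (sigma e)"
    and "sig' (\<lambda>i. - delta i) (complexify prism L) k m = of_real (- H k m)"
    by (simp_all add: h_def)
qed

lemma sig'_eq:
  assumes "k \<noteq> m"
  shows "sig' (\<lambda>i. - delta i) (complexify prism L) k m = of_real (- H k m)"
proof -
  have "ends (edge_joining k m) = (k, m) \<or> ends (edge_joining k m) = (m, k)"
    using verts_edge_joining[OF assms]
    by (cases "ends (edge_joining k m)") (auto simp: verts_def doubleton_eq_iff)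
  moreover have "sig' (\<lambda>i. - delta i) (complexify prism L) k m = sig' (\<lambda>i. - delta i) (complexify prism L) m k"
    by (simp add: sig'_def edge_joining_commute[of k m] mult.commute)
  ultimately show ?thesis using sig_ends(2) H_commute[of k m] by metis
qed

lemma Smat_complexify:
  "Smat (\<lambda>i. - delta i) (complexify prism L) $ e $ f = of_real (Smat_real H e f)"
proof -
  obtain k m where km: "ends e = (k, m)" by fastforce
  obtain i j where ij: "ends (opposite e) = (i, j)" by fastforce
  have dist: "distinct [k, m, i, j]" using ends_distinct[OF km ij] .
  have "(sig (\<lambda>i. - delta i) (complexify prism L) k m)\<^sup>2 = of_real ((H k m)\<^sup>2 - delta k * delta m)"
  proof -
    have "(sig (\<lambda>i. - delta i) (complexify prism L) k m)\<^sup>2 = of_real (kappa prism e * (sigma e)\<^sup>2)"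
      unfolding sig_ends(1)[OF km] by (simp add: power_mult_distrib power2_eq_square[of "unit_of prism e"] unit_of_squared)
    then show ?thesis unfolding sigma_squared[OF km] by simp
  qed
  moreover have sig': "sig' (\<lambda>i. - delta i) (complexify prism L) p q = of_real (- H p q)"
    if "p \<in> {i, j}" "q \<in> {k, m}" for p q
    using that dist by (intro sig'_eq) auto
  ultimately have omega: "omega (\<lambda>i. - delta i) (complexify prism L) e = of_real (Smat_real H e e)"
    by (simp add: omega_def Smat_real_def km ij sig' sig_ends(2)[OF km] algebra_simps)
  show ?thesis
  proof (cases "f = e \<or> f = opposite e")
    case True
    then show ?thesis using omega by (auto simp: Smat_def Smat_real_def)
  next
    case False
    then obtain i j k l where ef: "distinct [i, j, k, l]" "e = edge_joining i j" "f = edge_joining j l"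
      using adjacent_edges_cases by blast
    have "Smat (\<lambda>i. - delta i) (complexify prism L) $ e $ f
        = of_real (- delta j) * sig' (\<lambda>i. - delta i) (complexify prism L) k j"
      using False unfolding ef(2,3) Smat_def the_common_vertex[OF ef(1)] Let_def
      by (simp add: the_common_vertex[OF ef(1)] del: Int_iff Un_iff)
    then show ?thesis
      unfolding ef(2,3) Smat_real_adjacent[OF ef(1)] using ef(1) sig'_eq[of k j] by auto
  qed
qed

text \<open>The two factors \<open>\<sigma>\<close> contribute the units of both edges, whereas the chain rule asks for the unit of \<open>e\<close>
  divided by that of \<open>f\<close>. The difference is the square of the unit of \<open>f\<close>, which is \<open>kappa prism f\<close>.\<close>
lemma Jac_formula_complexify:
  "Jac_formula (\<lambda>i. - delta i) (complexify prism a) (complexify prism L)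
    = (\<chi> e f. unit_of prism e * of_real (jac $ e $ f) / unit_of prism f)"
proof -
  have D: "Dmat (\<lambda>i. - delta i) (complexify prism L) $ e $ e = unit_of prism e * of_real (sigma e)" for e
    using sig_ends(1)[of e "fst (ends e)" "snd (ends e)"] by (simp add: Dmat_def)
  have u: "1 / unit_of prism f * of_real (kappa prism f) = unit_of prism f" for f
    by (simp add: unit_of_def unit_factor_def kappa_def)
  have "Jac_formula (\<lambda>i. - delta i) (complexify prism a) (complexify prism L) $ e $ f
      = unit_of prism e * of_real (jac $ e $ f) / unit_of prism f" for e f
    unfolding Jac_formula_entry eta_complexify D Smat_complexify jac_def
    by (subst (2) u[symmetric]) (simp add: mult_ac)
  then show ?thesis by (simp add: vec_eq_iff)
qed

end

lemma truncated_jacobian: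
  assumes v: "truncated prism v"
  shows "\<exists>J. has_jacobian {(angles prism w, lengths prism w) | w. truncated prism w} (angles prism v) J \<and>
    (\<chi> e f. unit_of prism e * of_real (J $ e $ f) / unit_of prism f)
      = Jac_formula (eps v) (complexify prism (angles prism v)) (complexify prism (lengths prism v))"
proof -
  have dv: "doubly_truncated v" using v by (simp add: truncated_iff)
  interpret gram_point prism "angles prism v" "\<lambda>i j. lor (v i) (v j)" "weight v (outward_normal v)"
    using v outward_normals_doubly_truncated[OF dv] by (rule gram_point_angles)
  have "eps v = (\<lambda>i. - delta i)"
    using eps_doubly_truncated[OF dv] by (auto simp: delta_def)
  then show ?thesis
    using has_jacobian_truncated[OF v] Jac_formula_complexify by (auto simp: lengths_eq_length_map[OF v])
qed

text \<open>The two conjuncts are the two values of the flag in \<open>truncated_jacobian\<close>.\<close>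
theorem theorem7:
  fixes v :: "4 \<Rightarrow> minkowski"
  assumes "prism_truncated v"
  shows "(\<exists>J. is_Jac_star v J \<and>
            continued_jacobian J =
              Jac_formula (eps v) (continued (prism_args v)) (continued (prism_vals v))) \<and>
         (\<forall>w. mildly_truncated w \<longrightarrow>
            (\<exists>J. is_mild_Jac w J \<and>
               (\<chi> e f. complex_of_real (J $ e $ f)) =
                 Jac_formula (eps w) (\<chi> e. complex_of_real (mild_angles w $ e))
                   (\<chi> e. complex_of_real (mild_lengths w $ e))))"
  using truncated_jacobian[of True v] truncated_jacobian[of False] assms
  by (simp add: truncated_def[abs_def] angles_def[abs_def] lengths_def[abs_def] is_Jac_star_def is_mild_Jac_def continued_jacobian_def
      continued_def complexify_def unit_of_def)

end
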